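(* For $\lambda>0$ and $\theta\in[0,1)$ let $H$ be the Fibonacci Hamiltonian on $\ell^2(\mathbb{Z})$, $[Hu](n)=u(n+1)+u(n-1)+V(n)u(n)$ with $$V(n)=\lambda\,\chi_{[1-\phi^{-1},1)}(n\phi^{-1}+\theta \bmod 1),\qquad \phi=\frac{\sqrt5+1}{2},$$ and let $S_u(\lambda)=2\lambda+22$. There is a constant $C$ such that for every $\lambda>\sqrt{24}$, every $\theta\in[0,1)$ and every $p>0$, $$\langle\beta^-_{\delta_0}(p)\rangle\ge\frac{2\log\phi}{\log S_u(\lambda)}-\frac2p\left(1+\frac{C\log\lambda}{\log S_u(\lambda)}\right),$$ and therefore, for every $\lambda>\sqrt{24}$ and every $\theta\in[0,1)$, $$\langle\alpha_u^-\rangle\ge\frac{2\log\phi}{\log S_u(\lambda)}.$$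
   Context: $\{\delta_n\}_{n\in\mathbb{Z}}$ is the standard basis of $\ell^2(\mathbb{Z})$ and $\chi_A$ is the indicator function of $A$. Time averages: for a function $f$ of $t>0$ and $T>0$, $\langle f\rangle(T)=\frac2T\int_0^\infty e^{-2t/T}f(t)\,dt$. Outside probabilities: for real $N$, $P(N,t)=\sum_{n\ge N}|\langle e^{-itH}\delta_0,\delta_n\rangle|^2+\sum_{n\le -N}|\langle e^{-itH}\delta_0,\delta_n\rangle|^2$ (sums over integers $n$), and $\langle P(N,\cdot)\rangle(T)$ is its time average in $t$. For $\alpha\ge0$ let $$\langle S^-(\alpha)\rangle=-\liminf_{T\to\infty}\frac{\log\langle P(T^\alpha-1,\cdot)\rangle(T)}{\log T}\in[0,\infty],\qquad \langle\alpha_u^-\rangle=\sup\{\alpha\ge0:\langle S^-(\alpha)\rangle<\infty\}.$$ Moments and transport exponent: for $p>0$, $\langle|X|^p_{\delta_0}\rangle(t)=\sum_{n\in\mathbb{Z}}|n|^p|\langle e^{-itH}\delta_0,\delta_n\rangle|^2$, with time average $\langle\langle|X|^p_{\delta_0}\rangle\rangle(T)$, and $$\langle\beta^-_{\delta_0}(p)\rangle=\liminf_{T\to\infty}\frac{\log\langle\langle|X|^p_{\delta_0}\rangle\rangle(T)}{p\log T}.$$ *)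

theory Defs
  imports "HOL-Analysis.Analysis"
begin

section \<open>The Hilbert space of square-summable two-sided sequences\<close>

typedef l2Z = "{f :: int \<Rightarrow> complex. (\<lambda>n. (cmod (f n))\<^sup>2) summable_on UNIV}"
  morphisms coord Abs_l2Z
  by (rule exI[of _ "\<lambda>_. 0"]) simp

setup_lifting type_definition_l2Z

lemma coord_summable: "(\<lambda>n. (cmod (coord x n))\<^sup>2) summable_on UNIV"
  using coord by simp

lemma l2_add:
  fixes f g :: "int \<Rightarrow> complex"
  assumes "(\<lambda>n. (cmod (f n))\<^sup>2) summable_on UNIV" "(\<lambda>n. (cmod (g n))\<^sup>2) summable_on UNIV"
  shows "(\<lambda>n. (cmod (f n + g n))\<^sup>2) summable_on UNIV"
proof (rule summable_on_comparison_test)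
  show "(\<lambda>n. 2 * (cmod (f n))\<^sup>2 + 2 * (cmod (g n))\<^sup>2) summable_on UNIV"
    by (intro summable_on_add summable_on_cmult_right assms)
  fix n
  have "(cmod (f n + g n))\<^sup>2 \<le> (cmod (f n) + cmod (g n))\<^sup>2"
    by (intro power_mono norm_triangle_ineq) auto
  also have "\<dots> \<le> 2 * (cmod (f n))\<^sup>2 + 2 * (cmod (g n))\<^sup>2"
    using sum_squares_bound[of "cmod (f n)" "cmod (g n)"] by (simp add: power2_sum)
  finally show "(cmod (f n + g n))\<^sup>2 \<le> 2 * (cmod (f n))\<^sup>2 + 2 * (cmod (g n))\<^sup>2" .
qed auto

lemma l2_mult_bounded:
  fixes f :: "int \<Rightarrow> complex"
  assumes "(\<lambda>n. (cmod (f n))\<^sup>2) summable_on UNIV" "\<And>n. cmod (c n) \<le> B"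
  shows "(\<lambda>n. (cmod (c n * f n))\<^sup>2) summable_on UNIV"
proof (rule summable_on_comparison_test)
  show "(\<lambda>n. B\<^sup>2 * (cmod (f n))\<^sup>2) summable_on UNIV"
    by (intro summable_on_cmult_right assms)
  fix n
  have "(cmod (c n))\<^sup>2 \<le> B\<^sup>2"
    by (intro power_mono assms) auto
  then show "(cmod (c n * f n))\<^sup>2 \<le> B\<^sup>2 * (cmod (f n))\<^sup>2"
    by (simp add: norm_mult power_mult_distrib mult_right_mono)
qed auto

lemma bij_int_shift: "bij (\<lambda>n::int. n + k)"
  by (rule bij_betw_byWitness[where f' = "\<lambda>n. n - k"]) auto

lemma l2_shift:
  fixes f :: "int \<Rightarrow> complex"
  assumes "(\<lambda>n. (cmod (f n))\<^sup>2) summable_on UNIV"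
  shows "(\<lambda>n. (cmod (f (n + k)))\<^sup>2) summable_on UNIV"
  using summable_on_reindex_bij_betw[OF bij_int_shift[of k], of "\<lambda>n. (cmod (f n))\<^sup>2"] assms
  by simp

lemma l2_product:
  fixes f g :: "int \<Rightarrow> complex"
  assumes "(\<lambda>n. (cmod (f n))\<^sup>2) summable_on UNIV" "(\<lambda>n. (cmod (g n))\<^sup>2) summable_on UNIV"
  shows "(\<lambda>n. f n * cnj (g n)) summable_on UNIV"
proof (rule abs_summable_summable, rule summable_on_comparison_test)
  show "(\<lambda>n. (cmod (f n))\<^sup>2 + (cmod (g n))\<^sup>2) summable_on UNIV"
    by (intro summable_on_add assms)
  fix n
  have "0 \<le> cmod (f n) * cmod (g n)" by simp
  then show "norm (f n * cnj (g n)) \<le> (cmod (f n))\<^sup>2 + (cmod (g n))\<^sup>2"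
    using sum_squares_bound[of "cmod (f n)" "cmod (g n)"]
    unfolding norm_mult complex_mod_cnj by linarith
qed auto

instantiation l2Z :: real_vector
begin
lift_definition zero_l2Z :: l2Z is "\<lambda>_. 0" by simp
lift_definition plus_l2Z :: "l2Z \<Rightarrow> l2Z \<Rightarrow> l2Z" is "\<lambda>f g n. f n + g n" by (rule l2_add)
lift_definition uminus_l2Z :: "l2Z \<Rightarrow> l2Z" is "\<lambda>f n. - f n" by simp
lift_definition minus_l2Z :: "l2Z \<Rightarrow> l2Z \<Rightarrow> l2Z" is "\<lambda>f g n. f n - g n"
  subgoal for f g using l2_add[of f "\<lambda>n. - g n"] by simp done
lift_definition scaleR_l2Z :: "real \<Rightarrow> l2Z \<Rightarrow> l2Z" is "\<lambda>r f n. of_real r * f n"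
  by (rule l2_mult_bounded) auto
instance
  by standard (transfer; simp add: algebra_simps fun_eq_iff)+
end

lift_definition cscale :: "complex \<Rightarrow> l2Z \<Rightarrow> l2Z" is "\<lambda>z f n. z * f n"
  by (rule l2_mult_bounded) auto

definition cinner :: "l2Z \<Rightarrow> l2Z \<Rightarrow> complex" where
  "cinner u v = (\<Sum>\<^sub>\<infinity>n. coord u n * cnj (coord v n))"

text \<open>The real inner product below is the real part of \<^const>\<open>cinner\<close>; it serves to obtain the
  norm and the topology of the space.\<close>

instantiation l2Z :: real_inner
begin
definition inner_l2Z :: "l2Z \<Rightarrow> l2Z \<Rightarrow> real" where
  "inner_l2Z u v = Re (cinner u v)"
definition norm_l2Z :: "l2Z \<Rightarrow> real" where
  "norm_l2Z u = sqrt (inner u u)"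
definition dist_l2Z :: "l2Z \<Rightarrow> l2Z \<Rightarrow> real" where
  "dist_l2Z u v = norm (u - v)"
definition sgn_l2Z :: "l2Z \<Rightarrow> l2Z" where
  "sgn_l2Z u = u /\<^sub>R norm u"
definition uniformity_l2Z :: "(l2Z \<times> l2Z) filter" where
  "uniformity_l2Z = (INF e\<in>{0<..}. principal {(u, v). dist u v < e})"
definition open_l2Z :: "l2Z set \<Rightarrow> bool" where
  "open_l2Z U = (\<forall>x\<in>U. \<forall>\<^sub>F (x', y) in uniformity. x' = x \<longrightarrow> y \<in> U)"

lemma inner_l2Z_infsum: "inner u v = (\<Sum>\<^sub>\<infinity>n. Re (coord u n * cnj (coord v n)))"
  unfolding inner_l2Z_def cinner_def
  by (intro infsum_Re[symmetric] l2_product coord_summable)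

lemma inner_l2Z_self: "inner u u = (\<Sum>\<^sub>\<infinity>n. (cmod (coord u n))\<^sup>2)"
  unfolding inner_l2Z_infsum cmod_power2 by (simp add: power2_eq_square)

instance
proof
  fix x y z :: l2Z and r :: real
  have sm: "(\<lambda>n. Re (coord u n * cnj (coord v n))) summable_on UNIV" for u v
    by (intro summable_on_Re l2_product coord_summable)
  show "dist x y = norm (x - y)" by (rule dist_l2Z_def)
  show "sgn x = x /\<^sub>R norm x" by (rule sgn_l2Z_def)
  show "uniformity = (INF e\<in>{0<..}. principal {(u::l2Z, v). dist u v < e})"
    by (rule uniformity_l2Z_def)
  show "open U = (\<forall>x\<in>U. \<forall>\<^sub>F (x', y) in uniformity. x' = x \<longrightarrow> y \<in> U)" for U :: "l2Z set"
    by (rule open_l2Z_def)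
  show "inner x y = inner y x"
    unfolding inner_l2Z_infsum by (simp add: mult.commute)
  show "inner (x + y) z = inner x z + inner y z"
    unfolding inner_l2Z_infsum
    by (subst infsum_add[symmetric, OF sm sm]) (simp add: plus_l2Z.rep_eq algebra_simps)
  show "inner (r *\<^sub>R x) y = r * inner x y"
    unfolding inner_l2Z_infsum
    by (subst infsum_cmult_right'[symmetric]) (simp add: scaleR_l2Z.rep_eq algebra_simps)
  show "0 \<le> inner x x"
    unfolding inner_l2Z_self by (rule infsum_nonneg) simp
  show "inner x x = 0 \<longleftrightarrow> x = 0"
  proof
    assume "inner x x = 0"
    then have "(cmod (coord x n))\<^sup>2 = 0" for n
      unfolding inner_l2Z_self
      by (intro nonneg_infsum_le_0D[OF _ coord_summable]) auto
    then show "x = 0"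
      by (intro coord_inject[THEN iffD1] ext) (simp add: zero_l2Z.rep_eq)
  qed (simp add: inner_l2Z_self zero_l2Z.rep_eq)
  show "norm x = sqrt (inner x x)" by (rule norm_l2Z_def)
qed
end

lemma norm_l2Z_power2: "(norm u)\<^sup>2 = (\<Sum>\<^sub>\<infinity>n. (cmod (coord u n))\<^sup>2)"
  by (simp add: power2_norm_eq_inner inner_l2Z_self)

lemma sum_coord_le_norm:
  "finite F \<Longrightarrow> (\<Sum>n\<in>F. (cmod (coord u n))\<^sup>2) \<le> (norm u)\<^sup>2"
  unfolding norm_l2Z_power2 by (rule finite_sum_le_infsum) (auto simp: coord_summable)

lemma coord_le_norm: "cmod (coord u n) \<le> norm u"
  using sum_coord_le_norm[of "{n}" u] by (simp add: power2_le_iff_abs_le)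

instance l2Z :: banach
proof
  fix X :: "nat \<Rightarrow> l2Z" assume X: "Cauchy X"
  have "Cauchy (\<lambda>k. coord (X k) n)" for n
  proof (rule metric_CauchyI)
    fix e :: real assume "e > 0"
    then obtain M where M: "\<And>i j. i \<ge> M \<Longrightarrow> j \<ge> M \<Longrightarrow> norm (X i - X j) < e"
      using X unfolding Cauchy_iff by meson
    have "dist (coord (X i) n) (coord (X j) n) \<le> norm (X i - X j)" for i j
      using coord_le_norm[of "X i - X j" n] by (simp add: dist_norm minus_l2Z.rep_eq)
    then show "\<exists>M. \<forall>i\<ge>M. \<forall>j\<ge>M. dist (coord (X i) n) (coord (X j) n) < e"
      using M by (meson le_less_trans)
  qed
  then have "\<forall>n. \<exists>l. (\<lambda>k. coord (X k) n) \<longlonglongrightarrow> l"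
    by (simp add: Cauchy_convergent_iff convergent_def)
  then obtain g where g: "\<And>n. (\<lambda>k. coord (X k) n) \<longlonglongrightarrow> g n"
    by metis
  have fin: "\<exists>M. \<forall>i\<ge>M. \<forall>F. finite F \<longrightarrow> (\<Sum>n\<in>F. (cmod (coord (X i) n - g n))\<^sup>2) \<le> e\<^sup>2"
    if "e > 0" for e :: real
  proof -
    obtain M where M: "\<And>i j. i \<ge> M \<Longrightarrow> j \<ge> M \<Longrightarrow> norm (X i - X j) < e"
      using X \<open>e > 0\<close> unfolding Cauchy_iff by meson
    have "(\<Sum>n\<in>F. (cmod (coord (X i) n - g n))\<^sup>2) \<le> e\<^sup>2" if i: "i \<ge> M" and "finite F" for i F
    proof (rule LIMSEQ_le_const2)
      show "(\<lambda>j. \<Sum>n\<in>F. (cmod (coord (X i) n - coord (X j) n))\<^sup>2)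
              \<longlonglongrightarrow> (\<Sum>n\<in>F. (cmod (coord (X i) n - g n))\<^sup>2)"
        by (intro tendsto_intros g)
      have "(\<Sum>n\<in>F. (cmod (coord (X i) n - coord (X j) n))\<^sup>2) \<le> e\<^sup>2" if "j \<ge> M" for j
      proof -
        have "(\<Sum>n\<in>F. (cmod (coord (X i - X j) n))\<^sup>2) \<le> (norm (X i - X j))\<^sup>2"
          by (rule sum_coord_le_norm) fact
        also have "\<dots> \<le> e\<^sup>2"
          using M[OF i that] by (intro power_mono) auto
        finally show ?thesis by (simp add: minus_l2Z.rep_eq)
      qed
      then show "\<exists>N. \<forall>j\<ge>N. (\<Sum>n\<in>F. (cmod (coord (X i) n - coord (X j) n))\<^sup>2) \<le> e\<^sup>2"
        by blast
    qed
    then show ?thesis by blast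
  qed
  have diff: "(\<lambda>n. (cmod (coord (X i) n - g n))\<^sup>2) summable_on UNIV"
    if "\<forall>F. finite F \<longrightarrow> (\<Sum>n\<in>F. (cmod (coord (X i) n - g n))\<^sup>2) \<le> e\<^sup>2" for i e
    using that by (intro nonneg_bdd_above_summable_on bdd_aboveI[of _ "e\<^sup>2"]) auto
  obtain M where "\<forall>F. finite F \<longrightarrow> (\<Sum>n\<in>F. (cmod (coord (X M) n - g n))\<^sup>2) \<le> 1\<^sup>2"
    using fin[of 1] by auto
  then have "(\<lambda>n. (cmod (coord (X M) n - g n))\<^sup>2) summable_on UNIV"
    by (rule diff)
  then have "(\<lambda>n. (cmod (g n - coord (X M) n))\<^sup>2) summable_on UNIV"
    by (simp add: norm_minus_commute)
  from l2_add[OF this coord_summable[of "X M"]]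
  have "(\<lambda>n. (cmod (g n))\<^sup>2) summable_on UNIV" by simp
  then have G: "coord (Abs_l2Z g) = g"
    by (simp add: Abs_l2Z_inverse)
  have "X \<longlonglongrightarrow> Abs_l2Z g"
  proof (rule metric_LIMSEQ_I)
    fix r :: real assume "r > 0"
    define e where "e = r / 2"
    have "e > 0" "e < r" using \<open>r > 0\<close> by (auto simp: e_def)
    from fin[OF \<open>e > 0\<close>] obtain M where
      M: "\<forall>i\<ge>M. \<forall>F. finite F \<longrightarrow> (\<Sum>n\<in>F. (cmod (coord (X i) n - g n))\<^sup>2) \<le> e\<^sup>2" by blast
    have "dist (X i) (Abs_l2Z g) < r" if "i \<ge> M" for i
    proof -
      have "(norm (X i - Abs_l2Z g))\<^sup>2 \<le> e\<^sup>2"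
        unfolding norm_l2Z_power2
        using M that diff[of i e]
        by (intro infsum_le_finite_sums) (auto simp: minus_l2Z.rep_eq G)
      then have "norm (X i - Abs_l2Z g) \<le> e"
        using \<open>e > 0\<close> by (simp add: power2_le_iff_abs_le)
      then show ?thesis using \<open>e < r\<close> by (simp add: dist_norm)
    qed
    then show "\<exists>no. \<forall>n\<ge>no. dist (X n) (Abs_l2Z g) < r" by blast
  qed
  then show "convergent X" by (auto simp: convergent_def)
qed

lift_definition std_basis :: "int \<Rightarrow> l2Z" is "\<lambda>k n. if n = k then 1 else 0"
proof -
  fix k :: int
  have "(\<lambda>n. (cmod (if n = k then 1 else 0))\<^sup>2) summable_on {k}"
    by (rule summable_on_finite) simp
  then show "(\<lambda>n. (cmod (if n = k then 1 else 0))\<^sup>2) summable_on UNIV"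
    by (rule summable_on_cong_neutral[THEN iffD1, rotated -1]) auto
qed

lemma cinner_std_basis: "cinner u (std_basis n) = coord u n"
proof -
  have "cinner u (std_basis n) = (\<Sum>\<^sub>\<infinity>m\<in>{n}. coord u m)"
    unfolding cinner_def by (rule infsum_cong_neutral) (auto simp: std_basis.rep_eq)
  then show ?thesis by simp
qed

section \<open>Unitary evolution\<close>

text \<open>For bounded linear \<open>A\<close> the power series converges in norm for every \<open>z\<close>
  (lemma \<open>op_exp_summable\<close>), so \<open>op_exp A z\<close> is the operator exponential of \<open>zA\<close>.\<close>

definition op_exp :: "(l2Z \<Rightarrow> l2Z) \<Rightarrow> complex \<Rightarrow> l2Z \<Rightarrow> l2Z" where
  "op_exp A z u = (\<Sum>k. cscale (z ^ k / fact k) ((A ^^ k) u))"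

definition evolution :: "(l2Z \<Rightarrow> l2Z) \<Rightarrow> real \<Rightarrow> l2Z \<Rightarrow> l2Z" where
  "evolution H t = op_exp H (- \<i> * of_real t)"

lemma norm_cscale: "norm (cscale z u) = cmod z * norm u"
proof (rule power2_eq_imp_eq)
  show "(norm (cscale z u))\<^sup>2 = (cmod z * norm u)\<^sup>2"
    by (simp add: norm_l2Z_power2 cscale.rep_eq norm_mult power_mult_distrib infsum_cmult_right')
qed auto

lemma op_exp_summable:
  fixes A :: "l2Z \<Rightarrow> l2Z"
  assumes "bounded_linear A"
  shows "summable (\<lambda>k. cscale (z ^ k / fact k) ((A ^^ k) u))"
proof -
  obtain K where K: "K > 0" "\<And>x. norm (A x) \<le> norm x * K"
    using bounded_linear.pos_bounded[OF assms] by blast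
  have pow: "norm ((A ^^ k) u) \<le> K ^ k * norm u" for k
  proof (induction k)
    case (Suc k)
    have "norm ((A ^^ Suc k) u) \<le> norm ((A ^^ k) u) * K"
      using K(2)[of "(A ^^ k) u"] by simp
    also have "\<dots> \<le> (K ^ k * norm u) * K" using Suc K(1) by (intro mult_right_mono) auto
    finally show ?case by (simp add: mult_ac)
  qed simp
  show ?thesis
  proof (rule summable_comparison_test')
    show "summable (\<lambda>k. (cmod z * K) ^ k /\<^sub>R fact k * norm u)"
      by (intro summable_mult2 summable_exp_generic)
    fix k :: nat assume "k \<ge> 0"
    have "norm (cscale (z ^ k / fact k) ((A ^^ k) u)) \<le> (cmod z ^ k / fact k) * (K ^ k * norm u)"
      unfolding norm_cscale norm_divide norm_power norm_fact
      by (intro mult_left_mono pow) auto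
    then show "norm (cscale (z ^ k / fact k) ((A ^^ k) u)) \<le> (cmod z * K) ^ k /\<^sub>R fact k * norm u"
      by (simp add: power_mult_distrib field_simps)
  qed
qed

section \<open>The Fibonacci Hamiltonian\<close>

definition golden :: real where
  "golden = (sqrt 5 + 1) / 2"

definition fib_potential :: "real \<Rightarrow> real \<Rightarrow> int \<Rightarrow> real" where
  "fib_potential lam \<theta> n =
     lam * indicat_real {1 - inverse golden..<1} (frac (of_int n * inverse golden + \<theta>))"

lemma fib_potential_bound: "cmod (of_real (fib_potential lam \<theta> n)) \<le> \<bar>lam\<bar>"
  by (simp add: fib_potential_def indicator_def)

lift_definition fib_hamiltonian :: "real \<Rightarrow> real \<Rightarrow> l2Z \<Rightarrow> l2Z" is
  "\<lambda>lam \<theta> u n. u (n + 1) + u (n - 1) + of_real (fib_potential lam \<theta> n) * u n"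
  subgoal for lam \<theta> f
    using l2_add[OF l2_add[OF l2_shift[of f 1] l2_shift[of f "-1"]]
        l2_mult_bounded[of f "\<lambda>n. of_real (fib_potential lam \<theta> n)", OF _ fib_potential_bound]]
    by simp
  done

lemma bounded_linear_fib_hamiltonian: "bounded_linear (fib_hamiltonian lam \<theta>)"
proof (rule bounded_linear_intro)
  show "fib_hamiltonian lam \<theta> (x + y) = fib_hamiltonian lam \<theta> x + fib_hamiltonian lam \<theta> y" for x y
    by transfer (simp add: algebra_simps)
  show "fib_hamiltonian lam \<theta> (r *\<^sub>R x) = r *\<^sub>R fib_hamiltonian lam \<theta> x" for r x
    by transfer (simp add: algebra_simps)
  fix u :: l2Z
  have shift: "coord (Abs_l2Z (\<lambda>n. coord u (n + k))) = (\<lambda>n. coord u (n + k))" for k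
    by (rule Abs_l2Z_inverse) (simp add: l2_shift coord_summable)
  have nshift: "norm (Abs_l2Z (\<lambda>n. coord u (n + k))) = norm u" for k
  proof (rule power2_eq_imp_eq)
    show "(norm (Abs_l2Z (\<lambda>n. coord u (n + k))))\<^sup>2 = (norm u)\<^sup>2"
      unfolding norm_l2Z_power2 shift
      using infsum_reindex_bij_betw[OF bij_int_shift[of k], of "\<lambda>n. (cmod (coord u n))\<^sup>2"] by simp
  qed auto
  define w where "w = Abs_l2Z (\<lambda>n. of_real (fib_potential lam \<theta> n) * coord u n)"
  have w: "coord w = (\<lambda>n. of_real (fib_potential lam \<theta> n) * coord u n)"
    unfolding w_def
    by (rule Abs_l2Z_inverse)
      (simp only: mem_Collect_eq l2_mult_bounded[OF coord_summable fib_potential_bound])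
  have "(norm w)\<^sup>2 \<le> (\<bar>lam\<bar> * norm u)\<^sup>2"
    unfolding power_mult_distrib norm_l2Z_power2 infsum_cmult_right'[symmetric]
  proof (rule infsum_mono)
    show "(\<lambda>n. \<bar>lam\<bar>\<^sup>2 * (cmod (coord u n))\<^sup>2) summable_on UNIV"
      by (intro summable_on_cmult_right coord_summable)
    show "(cmod (coord w n))\<^sup>2 \<le> \<bar>lam\<bar>\<^sup>2 * (cmod (coord u n))\<^sup>2" for n
      unfolding w norm_mult power_mult_distrib
      by (intro mult_right_mono power_mono fib_potential_bound) auto
  qed (rule coord_summable)
  then have nw: "norm w \<le> \<bar>lam\<bar> * norm u"
    by (rule power2_le_imp_le) auto
  have eq: "fib_hamiltonian lam \<theta> u =
      Abs_l2Z (\<lambda>n. coord u (n + 1)) + Abs_l2Z (\<lambda>n. coord u (n + (-1))) + w"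
    by (intro coord_inject[THEN iffD1] ext)
      (simp only: fib_hamiltonian.rep_eq plus_l2Z.rep_eq shift w, simp)
  have "norm (fib_hamiltonian lam \<theta> u) \<le> norm u + norm u + \<bar>lam\<bar> * norm u"
    unfolding eq
    using norm_triangle_ineq[of "Abs_l2Z (\<lambda>n. coord u (n + 1)) + Abs_l2Z (\<lambda>n. coord u (n + (-1)))" w]
      norm_triangle_ineq[of "Abs_l2Z (\<lambda>n. coord u (n + 1))" "Abs_l2Z (\<lambda>n. coord u (n + (-1)))"]
      nw nshift[of 1] nshift[of "-1"] by linarith
  then show "norm (fib_hamiltonian lam \<theta> u) \<le> norm u * (2 + \<bar>lam\<bar>)"
    by (simp add: algebra_simps)
qed

definition S_u :: "real \<Rightarrow> real" where
  "S_u lam = 2 * lam + 22"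

section \<open>Transport exponents\<close>

definition time_average :: "(real \<Rightarrow> ennreal) \<Rightarrow> real \<Rightarrow> ennreal" where
  "time_average f T =
     ennreal (2 / T) * (\<integral>\<^sup>+ t\<in>{0..}. ennreal (exp (- 2 * t / T)) * f t \<partial>lborel)"

definition ln_ennreal :: "ennreal \<Rightarrow> ereal" where
  "ln_ennreal x = (if x = 0 then - \<infinity> else if x = \<infinity> then \<infinity> else ereal (ln (enn2real x)))"

definition site_prob :: "(l2Z \<Rightarrow> l2Z) \<Rightarrow> real \<Rightarrow> int \<Rightarrow> real" where
  "site_prob H t n = (cmod (cinner (evolution H t (std_basis 0)) (std_basis n)))\<^sup>2"

text \<open>For \<open>N \<le> 0\<close> the two index sets overlap, and the overlap is counted twice.\<close>

definition outside_prob :: "(l2Z \<Rightarrow> l2Z) \<Rightarrow> real \<Rightarrow> real \<Rightarrow> ennreal" where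
  "outside_prob H N t =
     (\<Sum>\<^sub>\<infinity>n\<in>{n. N \<le> of_int n}. ennreal (site_prob H t n)) +
     (\<Sum>\<^sub>\<infinity>n\<in>{n. of_int n \<le> - N}. ennreal (site_prob H t n))"

definition S_minus :: "(l2Z \<Rightarrow> l2Z) \<Rightarrow> real \<Rightarrow> ereal" where
  "S_minus H \<alpha> =
     - Liminf at_top (\<lambda>T::real.
         ln_ennreal (time_average (outside_prob H (T powr \<alpha> - 1)) T) / ereal (ln T))"

definition alpha_u_minus :: "(l2Z \<Rightarrow> l2Z) \<Rightarrow> ereal" where
  "alpha_u_minus H = Sup {ereal \<alpha> | \<alpha>. 0 \<le> \<alpha> \<and> S_minus H \<alpha> < \<infinity>}"

definition moment :: "(l2Z \<Rightarrow> l2Z) \<Rightarrow> real \<Rightarrow> real \<Rightarrow> ennreal" where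
  "moment H p t = (\<Sum>\<^sub>\<infinity>n. ennreal (\<bar>of_int n\<bar> powr p * site_prob H t n))"

definition beta_minus :: "(l2Z \<Rightarrow> l2Z) \<Rightarrow> real \<Rightarrow> ereal" where
  "beta_minus H p =
     Liminf at_top (\<lambda>T::real. ln_ennreal (time_average (moment H p) T) / ereal (p * ln T))"

end

theory Submission
  imports Defs "HOL-Number_Theory.Fib"
begin

text \<open>The traces \<open>x\<^sub>k(z)\<close> of the transfer matrices over the Fibonacci words satisfy
  \<open>x\<^sub>k\<^sub>+\<^sub>1 = x\<^sub>k x\<^sub>k\<^sub>-\<^sub>1 - x\<^sub>k\<^sub>-\<^sub>2\<close>. A shooting argument produces a real energy \<open>E\<close> whose trace orbit
  alternates between values near \<open>1\<close> and values near \<open>\<lambda>\<close>. Along this orbit a perturbation of the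
  energy grows by a factor of at most \<open>S\<^sub>u(\<lambda>)\<close> in two steps, so the traces at \<open>E + 2i/T\<close> stay
  bounded up to scale \<open>\<phi>\<^sup>2\<^sup>k\<close> as long as \<open>S\<^sub>u(\<lambda>)\<^sup>k\<close> is a small multiple of \<open>T\<close>.

  For every phase, each site is followed (and, by reflection, preceded) by a square in the
  Fibonacci sequence with period of that scale. The Cayley--Hamilton theorem then bounds the
  resolvent kernel \<open>u\<close> near the site \<open>0\<close> by its values at the two ends of the square, and since
  \<open>(H - z)u = - i \<delta>\<^sub>0\<close>, the kernel is bounded below at some site of modulus at least
  \<open>T\<^sup>\<alpha>\<close>. As \<open>u\<close> is the Laplace transform of the evolution, Cauchy--Schwarz turns this single
  value at a single energy into a lower bound of order \<open>T\<^sup>-\<^sup>2\<close> for the averaged probability of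
  that site. In particular \<open>C = 0\<close> is admissible.\<close>

section \<open>Trace orbits\<close>

text \<open>The index is shifted by one: \<open>trace_seq \<lambda> z n\<close> is \<open>x\<^sub>n\<^sub>-\<^sub>1(z)\<close>, where \<open>x\<^sub>-\<^sub>1 = 2\<close>.\<close>

fun trace_seq :: "'a::comm_ring_1 \<Rightarrow> 'a \<Rightarrow> nat \<Rightarrow> 'a" where
  "trace_seq l z 0 = 2"
| "trace_seq l z (Suc 0) = z"
| "trace_seq l z (Suc (Suc 0)) = z - l"
| "trace_seq l z (Suc (Suc (Suc n))) =
     trace_seq l z (Suc (Suc n)) * trace_seq l z (Suc n) - trace_seq l z n"

declare trace_seq.simps(4) [simp del]
lemmas trace_seq_rec = trace_seq.simps(4)

lemma trace_seq_of_real: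
  "trace_seq (of_real l) (of_real z) n = (of_real (trace_seq l z n) :: complex)"
  by (induction l z n rule: trace_seq.induct) (auto simp: trace_seq_rec)

text \<open>Add the recursion for index \<open>n + 4\<close> to the one for \<open>n + 3\<close>
  solved for the term \<open>n\<close>. At even \<open>n\<close> the identity singles out 1 as the
  value near which the even traces can stay while the odd ones are large.\<close>

lemma trace_seq_two_step:
  "trace_seq l z n + trace_seq l z (n + 4) =
     (trace_seq l z (n + 2) - 1) * (trace_seq l z (n + 3) + trace_seq l z (n + 1))"
  by (simp add: trace_seq_rec eval_nat_numeral algebra_simps)

text \<open>The Fricke-Vogt invariant of the trace map, with its value fixed by the initial
  traces.\<close>

lemma trace_seq_invariant:
  "(trace_seq l z n)\<^sup>2 + (trace_seq l z (n + 1))\<^sup>2 + (trace_seq l z (n + 2))\<^sup>2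
     - trace_seq l z n * trace_seq l z (n + 1) * trace_seq l z (n + 2) = 4 + l\<^sup>2"
proof (induction n)
  case 0
  show ?case by (simp add: power2_eq_square eval_nat_numeral algebra_simps)
next
  case (Suc n)
  then show ?case
    by (simp add: trace_seq_rec eval_nat_numeral algebra_simps)
qed

lemma continuous_on_trace_seq [continuous_intros]:
  "continuous_on A (\<lambda>z. trace_seq l z n :: real)"
proof (induction n rule: less_induct)
  case (less n)
  consider "n = 0" | "n = 1" | "n = 2" | m where "n = Suc (Suc (Suc m))"
    by (metis One_nat_def Suc_1 not0_implies_Suc)
  then show ?case
  proof cases
    case 4
    then show ?thesis
      by (simp add: trace_seq_rec) (intro continuous_intros less; simp)
  qed (simp_all add: numeral_2_eq_2 continuous_intros)
qed

section \<open>A real energy with a controlled trace orbit\<close>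

lemma gt_sqrt_24:
  assumes "sqrt 24 < lam"
  shows "4.8 < lam"
proof -
  have "sqrt (4.8\<^sup>2) < sqrt 24" by (subst real_sqrt_less_iff) (simp add: power2_eq_square)
  with assms show ?thesis by simp
qed

text \<open>Let \<open>r'\<close> be the first point where \<open>g\<close> takes the value
  \<open>b\<close>, and \<open>l'\<close> the last point before it where \<open>g\<close> takes the
  value \<open>a\<close>. By the intermediate value theorem \<open>g\<close> cannot leave the window
  in between.\<close>

lemma crossing_subinterval:
  fixes g :: "real \<Rightarrow> real"
  assumes cont: "continuous_on {l..r} g" and lr: "l \<le> r" and ab: "a \<le> b"
    and l: "g l \<le> a" and r: "b \<le> g r"
  obtains l' r' where "l \<le> l'" "l' \<le> r'" "r' \<le> r" "g l' = a" "g r' = b"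
    "\<And>x. x \<in> {l'..r'} \<Longrightarrow> g x \<in> {a..b}"
proof -
  define B where "B = {x \<in> {l..r}. g x = b}"
  have cB: "compact B" unfolding B_def compact_eq_bounded_closed
    by (auto intro!: bounded_subset[OF bounded_closed_interval[of l r]]
        continuous_closed_preimage_constant[OF cont, simplified] )
  have neB: "B \<noteq> {}"
    using IVT'[of g l b r] l r lr ab cont by (force simp: B_def)
  obtain r' where r': "r' \<in> B" "\<And>x. x \<in> B \<Longrightarrow> r' \<le> x"
    using compact_attains_inf[OF cB neB] by blast
  have cont': "continuous_on {l..r'} g"
    using cont r'(1) by (auto simp: B_def intro: continuous_on_subset)
  define A where "A = {x \<in> {l..r'}. g x = a}"
  have cA: "compact A" unfolding A_def compact_eq_bounded_closed
    by (auto intro!: bounded_subset[OF bounded_closed_interval[of l r']]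
        continuous_closed_preimage_constant[OF cont', simplified])
  have neA: "A \<noteq> {}"
    using IVT'[of g l a r'] l r'(1) ab cont' by (force simp: A_def B_def)
  obtain l' where l': "l' \<in> A" "\<And>x. x \<in> A \<Longrightarrow> x \<le> l'"
    using compact_attains_sup[OF cA neA] by blast
  show ?thesis
  proof (rule that[of l' r'])
    fix x assume x: "x \<in> {l'..r'}"
    have "g x \<le> b"
    proof (rule ccontr)
      assume "\<not> g x \<le> b"
      then obtain y where "l \<le> y" "y \<le> x" "g y = b"
        using IVT'[of g l b x] l ab x l'(1) r'(1) continuous_on_subset[OF cont']
        by (force simp: A_def)
      moreover have "x = y"
        using r'(2)[of y] x r'(1) calculation by (auto simp: B_def)
      ultimately show False using \<open>\<not> g x \<le> b\<close> by simp
    qed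
    moreover have "a \<le> g x"
    proof (rule ccontr)
      assume "\<not> a \<le> g x"
      then obtain y where "x \<le> y" "y \<le> r'" "g y = a"
        using IVT'[of g x a r'] ab x l'(1) r'(1) continuous_on_subset[OF cont', of "{x..r'}"]
        by (force simp: A_def B_def)
      moreover have "x = y"
        using l'(2)[of y] x l'(1) calculation by (auto simp: A_def)
      ultimately show False using \<open>\<not> a \<le> g x\<close> by simp
    qed
    ultimately show "g x \<in> {a..b}" by simp
  qed (use l' r' in \<open>auto simp: A_def B_def\<close>)
qed

text \<open>The invariant is a quadratic equation for \<open>b\<close> whose coefficients are
  confined by the window for \<open>a\<close> and \<open>a'\<close>. For 2 \<le> b < lam its left
  side is below lam^2 + (a - a')^2, hence too small; for b > lam + 2 the product b (b - 9/4) is too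
  large.\<close>

lemma odd_trace_bounds:
  fixes a a' b lam :: real
  assumes inv: "a\<^sup>2 + b\<^sup>2 + a'\<^sup>2 - a * b * a' = 4 + lam\<^sup>2"
    and a: "1/2 \<le> a" "a \<le> 3/2" and a': "1/2 \<le> a'" "a' \<le> 3/2"
    and b: "0 < b" and lam: "4 < lam"
  shows "lam \<le> b" "b \<le> lam + 2"
proof -
  have aa: "a\<^sup>2 \<le> 9/4" "a'\<^sup>2 \<le> 9/4"
    using a a' power_mono[of a "3/2" 2] power_mono[of a' "3/2" 2] by (auto simp: power2_eq_square)
  have p: "0 \<le> a * a'" using a a' by simp
  have p2: "a * a' \<le> 9/4"
    using mult_mono[of a "3/2" a' "3/2"] a a' by simp
  show "lam \<le> b"
  proof (rule ccontr)
    assume "\<not> lam \<le> b"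
    then have bl: "b\<^sup>2 < lam\<^sup>2" using b by (intro power_strict_mono) auto
    show False
    proof (cases "b \<ge> 2")
      case True
      have "a * b * a' \<ge> 2 * (a * a')"
        using mult_right_mono[OF True p] by (simp add: mult_ac)
      moreover have "(a - a')\<^sup>2 \<le> 1\<^sup>2"
        using a a' by (intro power2_le_iff_abs_le[THEN iffD2]) auto
      ultimately show False using inv bl by (simp add: power2_diff)
    next
      case False
      then have "b\<^sup>2 \<le> 2\<^sup>2" using b by (intro power_mono) auto
      moreover have "4\<^sup>2 < lam\<^sup>2" using lam by (intro power_strict_mono) auto
      moreover have "0 \<le> a * b * a'" using mult_nonneg_nonneg[OF p, of b] b by (simp add: mult_ac)
      ultimately show False using inv aa by simp
    qed
  qed
  show "b \<le> lam + 2"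
  proof (rule ccontr)
    assume *: "\<not> b \<le> lam + 2"
    have "a * b * a' \<le> 9/4 * b"
      using mult_right_mono[OF p2, of b] b by (simp add: mult_ac)
    moreover have "b * (b - 9/4) \<le> 4 + lam\<^sup>2"
    proof -
      have "b\<^sup>2 - 9/4 * b \<le> 4 + lam\<^sup>2"
        using inv zero_le_power2[of a] zero_le_power2[of a'] \<open>a * b * a' \<le> 9/4 * b\<close> by linarith
      then show ?thesis by (simp add: algebra_simps power2_eq_square)
    qed
    moreover from lam have "4 + lam\<^sup>2 < (lam + 2) * (lam - 1/4)"
      by (auto simp: algebra_simps power2_eq_square add_divide_distrib)
    moreover have "(lam + 2) * (lam - 1/4) \<le> b * (b - 9/4)"
      using * lam b by (intro mult_mono) auto
    ultimately show False by linarith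
  qed
qed

text \<open>On the interval, the traces with even index stay near the value 1, while those with odd
  index are of size \<open>lam\<close>; the end point conditions make the intermediate value theorem
  applicable to the next trace.\<close>

definition shooting_interval :: "real \<Rightarrow> nat \<Rightarrow> real \<Rightarrow> real \<Rightarrow> bool" where
  "shooting_interval lam j l r \<longleftrightarrow> l \<le> r \<and> lam + 1/2 \<le> l \<and> r \<le> lam + 3/2 \<and>
     trace_seq lam l (2 * j) = 1/2 \<and> trace_seq lam r (2 * j) = 3/2 \<and>
     (\<forall>E\<in>{l..r}. (\<forall>i\<in>{1..j}. trace_seq lam E (2 * i) \<in> {1/2..3/2}) \<and>
                 (\<forall>i<j. trace_seq lam E (2 * i + 1) \<in> {lam..lam + 2}))"

text \<open>At the end points the even trace of index \<open>2 * j\<close> is 1/2 and 3/2, so the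
  two-step identity makes the next even trace negative at \<open>l\<close> and at least 3/2 at
  \<open>r\<close>. It crosses the window on a subinterval, and there the invariant controls the odd
  trace in between.\<close>

lemma shooting_interval_step:
  assumes lam: "sqrt 24 < lam" and j: "1 \<le> j" and I: "shooting_interval lam j l r"
  shows "\<exists>l' r'. shooting_interval lam (Suc j) l' r'"
proof -
  have lam': "4.8 < lam" using lam by (rule gt_sqrt_24)
  obtain i where i: "j = Suc i" using j by (cases j) auto
  define a0 where "a0 E = trace_seq lam E (2 * i)" for E
  define b0 where "b0 E = trace_seq lam E (2 * i + 1)" for E
  define a1 where "a1 E = trace_seq lam E (2 * i + 2)" for E
  define b1 where "b1 E = trace_seq lam E (2 * i + 3)" for E
  define a2 where "a2 E = trace_seq lam E (2 * i + 4)" for E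
  have two: "a0 E + a2 E = (a1 E - 1) * (b1 E + b0 E)" for E
    unfolding a0_def a1_def a2_def b0_def b1_def by (rule trace_seq_two_step)
  have b1: "b1 E = a1 E * b0 E - a0 E" for E
    by (simp add: a0_def a1_def b0_def b1_def eval_nat_numeral trace_seq_rec)
  have inv: "(a1 E)\<^sup>2 + (b1 E)\<^sup>2 + (a2 E)\<^sup>2 - a1 E * b1 E * a2 E = 4 + lam\<^sup>2" for E
    using trace_seq_invariant[of lam E "2 * i + 2"] by (simp add: a1_def a2_def b1_def eval_nat_numeral)
  have lr: "l \<le> r" "lam + 1/2 \<le> l" "r \<le> lam + 3/2" "a1 l = 1/2" "a1 r = 3/2"
    and old: "\<And>E. E \<in> {l..r} \<Longrightarrow> (\<forall>i\<in>{1..j}. trace_seq lam E (2 * i) \<in> {1/2..3/2}) \<and>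
                 (\<forall>i<j. trace_seq lam E (2 * i + 1) \<in> {lam..lam + 2})"
    using I unfolding shooting_interval_def i by (auto simp: a1_def)
  have b0: "lam \<le> b0 E" "b0 E \<le> lam + 2" if "E \<in> {l..r}" for E
    using old[OF that] i by (auto simp: b0_def)
  have a1: "1/2 \<le> a1 E" "a1 E \<le> 3/2" if "E \<in> {l..r}" for E
    using old[OF that] i by (auto simp: a1_def dest!: bspec[of _ _ j])
  \<comment> \<open>The weaker upper bound accounts for \<open>i = 0\<close>, where the trace is the
    constant 2.\<close>
  have a0: "1/2 \<le> a0 E" "a0 E \<le> 2" if "E \<in> {l..r}" for E
  proof -
    have "a0 E \<in> {1/2..3/2} \<or> a0 E = 2"
      using old[OF that] i by (cases i) (auto simp: a0_def dest!: bspec[of _ _ i])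
    then show "1/2 \<le> a0 E" "a0 E \<le> 2" by auto
  qed
  have b1_pos: "0 < b1 E" if "E \<in> {l..r}" for E
    using mult_mono[OF a1(1)[OF that] b0(1)[OF that]] a0[OF that] lam' a1(1)[OF that] unfolding b1 by auto
  have "a2 l \<le> 1/2"
  proof -
    have "l \<in> {l..r}" using lr by simp
    moreover have "a0 l + a2 l = - 1/2 * (b1 l + b0 l)" using two[of l] lr(4) by simp
    ultimately show ?thesis using a0(1)[of l] b0(1)[of l] b1_pos[of l] lam' by argo
  qed
  moreover have "3/2 \<le> a2 r"
    using two[of r] lr a0[of r] b0[of r] b1[of r] lam' by simp
  moreover have "continuous_on {l..r} a2"
    unfolding a2_def by (rule continuous_on_trace_seq)
  ultimately obtain l' r' where lr': "l \<le> l'" "l' \<le> r'" "r' \<le> r" "a2 l' = 1/2" "a2 r' = 3/2"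
    and win: "\<And>x. x \<in> {l'..r'} \<Longrightarrow> a2 x \<in> {1/2..3/2}"
    using crossing_subinterval[of l r a2 "1/2" "3/2"] lr(1) by auto
  have "lam \<le> b1 E \<and> b1 E \<le> lam + 2" if "E \<in> {l'..r'}" for E
    using odd_trace_bounds[OF inv, of E] a1[of E] win[OF that] b1_pos[of E] lam' that lr' by auto
  then have "shooting_interval lam (Suc j) l' r'"
    unfolding shooting_interval_def
  proof (intro conjI ballI allI impI)
    fix E n assume E: "E \<in> {l'..r'}" and n: "n \<in> {1..Suc j}"
    show "trace_seq lam E (2 * n) \<in> {1/2..3/2}"
    proof (cases "n = Suc j")
      case True
      then show ?thesis using win[OF E] by (simp add: a2_def i eval_nat_numeral)
    next
      case False
      then show ?thesis using old[of E] E n lr' by auto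
    qed
  next
    fix E n assume E: "E \<in> {l'..r'}" and n: "n < Suc j"
      and b: "\<And>E. E \<in> {l'..r'} \<Longrightarrow> lam \<le> b1 E \<and> b1 E \<le> lam + 2"
    show "trace_seq lam E (2 * n + 1) \<in> {lam..lam + 2}"
    proof (cases "n = j")
      case True
      then show ?thesis using b[OF E] by (simp add: b1_def i eval_nat_numeral)
    next
      case False
      then show ?thesis using old[of E] E n lr' by auto
    qed
  qed (use lr lr' in \<open>auto simp: a2_def i eval_nat_numeral\<close>)
  then show ?thesis by blast
qed

lemma shooting_interval_exists:
  assumes lam: "sqrt 24 < lam"
  shows "\<exists>l r. shooting_interval lam (Suc j) l r"
proof (induction j)
  case 0
  \<comment> \<open>The trace of index 2 is \<open>z - lam\<close>, so this interval is mapped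
    exactly onto the window.\<close>
  have "shooting_interval lam (Suc 0) (lam + 1/2) (lam + 3/2)"
    unfolding shooting_interval_def by (auto simp: numeral_2_eq_2)
  then show ?case by blast
next
  case (Suc j)
  then show ?case using shooting_interval_step[OF lam, of "Suc j"] by auto
qed

text \<open>Shooting one step beyond \<open>k\<close> yields the last bound: in the two-step
  identity around index \<open>2 * j\<close> the outer even traces add up to at most 4, the odd ones
  to at least \<open>2 * lam\<close>.\<close>

lemma bounded_real_trace_orbit:
  assumes lam: "sqrt 24 < lam"
  obtains E where "lam \<le> E" "E \<le> lam + 2"
    "\<And>j. 1 \<le> j \<Longrightarrow> j \<le> k \<Longrightarrow> trace_seq lam E (2 * j) \<in> {1/2..3/2}"
    "\<And>j. j \<le> k \<Longrightarrow> trace_seq lam E (2 * j + 1) \<in> {lam..lam + 2}"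
    "\<And>j. 1 \<le> j \<Longrightarrow> j \<le> k \<Longrightarrow> \<bar>trace_seq lam E (2 * j) - 1\<bar> \<le> 2 / lam"
proof -
  have lam': "4 < lam" using gt_sqrt_24[OF lam] by simp
  obtain l r where I: "shooting_interval lam (Suc k) l r"
    using shooting_interval_exists[OF lam] by blast
  have a: "trace_seq lam l (2 * j) \<in> {1/2..3/2}" if "1 \<le> j" "j \<le> Suc k" for j
    using I that by (auto simp: shooting_interval_def)
  have b: "trace_seq lam l (2 * j + 1) \<in> {lam..lam + 2}" if "j \<le> k" for j
    using I that by (auto simp: shooting_interval_def)
  show ?thesis
  proof (rule that[of l])
    fix j assume j: "1 \<le> j" "j \<le> k"
    then obtain i where i: "j = Suc i" by (cases j) auto
    have "trace_seq lam l (2 * i) \<in> {1/2..2}"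
      using a[of i] i j by (cases i) auto
    moreover have two: "trace_seq lam l (2 * i) + trace_seq lam l (2 * Suc j) =
        (trace_seq lam l (2 * j) - 1) * (trace_seq lam l (2 * j + 1) + trace_seq lam l (2 * i + 1))"
      using trace_seq_two_step[of lam l "2 * i"] i by (simp add: eval_nat_numeral)
    moreover have "trace_seq lam l (2 * Suc j) \<in> {1/2..3/2}" using a[of "Suc j"] j by simp
    ultimately have s: "\<bar>trace_seq lam l (2 * j) - 1\<bar> * \<bar>trace_seq lam l (2 * j + 1) + trace_seq lam l (2 * i + 1)\<bar> \<le> 4"
      unfolding abs_mult[symmetric] by (simp add: abs_le_iff)
    have "\<bar>trace_seq lam l (2 * j) - 1\<bar> * (2 * lam) \<le> \<bar>trace_seq lam l (2 * j) - 1\<bar> * \<bar>trace_seq lam l (2 * j + 1) + trace_seq lam l (2 * i + 1)\<bar>"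
      using b[of i] b[of j] i j by (intro mult_left_mono) auto
    with s have "\<bar>trace_seq lam l (2 * j) - 1\<bar> * (2 * lam) \<le> 4" by linarith
    then show "\<bar>trace_seq lam l (2 * j) - 1\<bar> \<le> 2 / lam"
      using lam' by (simp add: field_simps)
  qed (use a b I in \<open>auto simp: shooting_interval_def\<close>)
qed

section \<open>Stability of the orbit under a complex perturbation\<close>

text \<open>\<open>A\<close> and \<open>B\<close> are the deviations at even and odd indices. The
  bound for \<open>B\<close> is \<open>q\<close> times larger, but \<open>B\<close> enters the next
  \<open>A\<close> with the factor \<open>2 / lam\<close>, and 2 q / lam \<le> 4; so the growth over
  two steps stays linear in \<open>lam\<close>. While deviations are at most 1, the quadratic terms
  only raise the constants.\<close>

lemma perturbed_trace_orbit:
  assumes lam: "sqrt 24 < lam" and eps: "0 \<le> \<epsilon>" and small: "(lam + 4) * \<epsilon> * (2 * lam + 22) ^ k \<le> 1"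
  obtains E where "lam \<le> E" "E \<le> lam + 2"
    "\<And>n. n \<le> 2 * k + 1 \<Longrightarrow> cmod (trace_seq (of_real lam) (Complex E \<epsilon>) n) \<le> lam + 3"
proof -
  have lam': "4.8 < lam" using lam by (rule gt_sqrt_24)
  define m where "m = 2 * lam + 22"
  define q where "q = lam + 4"
  have m: "1 \<le> m" "30 \<le> m" and q: "1 \<le> q" using lam' by (auto simp: m_def q_def)
  obtain E where E: "lam \<le> E" "E \<le> lam + 2"
    and aE: "\<And>j. 1 \<le> j \<Longrightarrow> j \<le> k \<Longrightarrow> trace_seq lam E (2 * j) \<in> {1/2..3/2}"
    and bE: "\<And>j. j \<le> k \<Longrightarrow> trace_seq lam E (2 * j + 1) \<in> {lam..lam + 2}"
    and cE: "\<And>j. 1 \<le> j \<Longrightarrow> j \<le> k \<Longrightarrow> \<bar>trace_seq lam E (2 * j) - 1\<bar> \<le> 2 / lam"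
    using bounded_real_trace_orbit[OF lam] by blast
  define z where "z = Complex E \<epsilon>"
  define x where "x n = complex_of_real (trace_seq lam E n)" for n
  define y where "y n = trace_seq (complex_of_real lam) z n" for n
  have x_alt: "x n = trace_seq (of_real lam) (of_real E) n" for n
    by (simp add: x_def trace_seq_of_real)
  define A where "A j = cmod (y (2 * j) - x (2 * j))" for j
  define B where "B j = cmod (y (2 * j + 1) - x (2 * j + 1))" for j
  have sm: "q * \<epsilon> * m ^ j \<le> 1" if "j \<le> k" for j
  proof -
    have "q * \<epsilon> * m ^ j \<le> q * \<epsilon> * m ^ k"
      using that m(1) q eps by (intro mult_left_mono power_increasing) auto
    with small show ?thesis by (simp add: q_def m_def)
  qed
  have Bstep: "B (Suc j) \<le> 3/2 * B j + (lam + 2) * A (Suc j) + A (Suc j) * B j + A j" if "Suc j \<le> k" for j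
  proof -
    have rec: "y (2 * Suc j + 1) = y (2 * Suc j) * y (2 * j + 1) - y (2 * j)"
      "x (2 * Suc j + 1) = x (2 * Suc j) * x (2 * j + 1) - x (2 * j)"
      by (simp_all add: y_def x_alt trace_seq_rec)
    have "y (2 * Suc j + 1) - x (2 * Suc j + 1) =
        x (2 * Suc j) * (y (2 * j + 1) - x (2 * j + 1))
        + x (2 * j + 1) * (y (2 * Suc j) - x (2 * Suc j))
        + (y (2 * Suc j) - x (2 * Suc j)) * (y (2 * j + 1) - x (2 * j + 1))
        - (y (2 * j) - x (2 * j))"
      unfolding rec by (simp add: algebra_simps)
    then have "B (Suc j) \<le> cmod (x (2 * Suc j)) * B j + cmod (x (2 * j + 1)) * A (Suc j)
        + A (Suc j) * B j + A j"
      unfolding A_def B_def norm_mult[symmetric]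
      by (smt (verit, best) norm_triangle_ineq norm_triangle_ineq4)
    also have "cmod (x (2 * Suc j)) * B j \<le> 3/2 * B j"
      using aE[of "Suc j"] that by (intro mult_right_mono) (auto simp: x_def B_def)
    also have "cmod (x (2 * j + 1)) * A (Suc j) \<le> (lam + 2) * A (Suc j)"
      using bE[of j] that lam' by (intro mult_right_mono) (auto simp: x_def A_def)
    finally show ?thesis by simp
  qed
  have Astep: "A (Suc (Suc j)) \<le> (2 * lam + 4) * A (Suc j) + 2 / lam * (B (Suc j) + B j)
      + A (Suc j) * (B (Suc j) + B j) + A j" if "Suc j \<le> k" for j
  proof -
    define dx where "dx = y (2 * Suc j) - x (2 * Suc j)"
    define b where "b = x (2 * Suc j + 1) + x (2 * j + 1)"
    define db where "db = (y (2 * Suc j + 1) - x (2 * Suc j + 1)) + (y (2 * j + 1) - x (2 * j + 1))"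
    have db: "cmod db \<le> B (Suc j) + B j"
      unfolding db_def B_def by (rule norm_triangle_ineq)
    have b: "cmod b \<le> 2 * lam + 4"
      using bE[of j] bE[of "Suc j"] that lam'
      unfolding b_def x_def of_real_add[symmetric] norm_of_real by auto
    have two: "y (2 * j) + y (2 * Suc (Suc j)) = (y (2 * Suc j) - 1) * (y (2 * Suc j + 1) + y (2 * j + 1))"
      "x (2 * j) + x (2 * Suc (Suc j)) = (x (2 * Suc j) - 1) * (x (2 * Suc j + 1) + x (2 * j + 1))"
      using trace_seq_two_step[of _ _ "2 * j"] by (simp_all add: y_def x_alt eval_nat_numeral)
    have "y (2 * Suc (Suc j)) - x (2 * Suc (Suc j)) =
        dx * b + (x (2 * Suc j) - 1) * db + dx * db - (y (2 * j) - x (2 * j))"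
      using two unfolding dx_def b_def db_def by algebra
    then have "A (Suc (Suc j)) \<le> cmod dx * cmod b + cmod (x (2 * Suc j) - 1) * cmod db + cmod dx * cmod db + A j"
      unfolding A_def norm_mult[symmetric]
      by (smt (verit, best) norm_triangle_ineq norm_triangle_ineq4)
    also have "cmod dx * cmod b \<le> A (Suc j) * (2 * lam + 4)"
      unfolding A_def dx_def by (intro mult_left_mono b) auto
    also have "cmod (x (2 * Suc j) - 1) = \<bar>trace_seq lam E (2 * Suc j) - 1\<bar>"
      unfolding x_def by (metis norm_of_real of_real_1 of_real_diff)
    also have "\<dots> * cmod db \<le> 2 / lam * (B (Suc j) + B j)"
      using cE[of "Suc j"] that lam' by (intro mult_mono db) auto
    also have "cmod dx * cmod db \<le> A (Suc j) * (B (Suc j) + B j)"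
      unfolding A_def dx_def by (intro mult_left_mono db) auto
    finally show ?thesis by (simp add: mult.commute)
  qed
  have main: "A j \<le> \<epsilon> * m ^ j \<and> B j \<le> q * \<epsilon> * m ^ j \<and> A (Suc j) \<le> \<epsilon> * m ^ Suc j" if "j \<le> k" for j
    using that
  proof (induction j)
    case 0
    have zE: "z - of_real E = \<i> * of_real \<epsilon>" by (simp add: z_def complex_eq_iff)
    have "A 0 = 0" by (simp add: A_def y_def x_def)
    moreover have "B 0 = \<epsilon>" using eps by (simp add: B_def y_def x_def zE norm_mult)
    moreover have "A (Suc 0) = \<epsilon>"
      using eps zE by (simp add: A_def y_def x_def numeral_2_eq_2 norm_mult)
    ultimately show ?case using eps m q mult_right_mono[of 1 q \<epsilon>] mult_left_mono[of 1 m \<epsilon>]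
      by (simp add: mult_ac)
  next
    case (Suc j)
    define e where "e = \<epsilon> * m ^ j"
    have e: "0 \<le> e" using eps m by (simp add: e_def)
    have IH: "A j \<le> e" "B j \<le> q * e" "A (Suc j) \<le> m * e"
      using Suc by (auto simp: e_def mult_ac)
    have nn: "0 \<le> A i" "0 \<le> B i" for i by (auto simp: A_def B_def)
    have qe: "q * (m * e) \<le> 1" using sm[OF Suc.prems] by (simp add: e_def mult_ac)
    have me: "m * e \<le> 1" using qe q mult_right_mono[of 1 q "m * e"] mult_nonneg_nonneg[of m e] e m by linarith
    have "A (Suc j) * B j \<le> 1 * B j"
      using IH(3) me nn by (intro mult_right_mono) auto
    moreover have "(lam + 2) * A (Suc j) \<le> (lam + 2) * (m * e)"
      using IH(3) lam' by (intro mult_left_mono) auto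
    ultimately have "B (Suc j) \<le> 5/2 * B j + (lam + 2) * (m * e) + A j"
      using Bstep[OF Suc.prems] by simp
    also have "\<dots> \<le> 5/2 * (q * e) + (lam + 2) * (m * e) + e"
      using IH by simp
    also have "\<dots> = (5/2 * q + (lam + 2) * m + 1) * e" by (simp add: algebra_simps)
    \<comment> \<open>As q = lam + 4, the difference of \<open>q * m\<close> and
      \<open>(lam + 2) * m\<close> is \<open>2 * m\<close>, which absorbs the other terms.\<close>
    also have "\<dots> \<le> (q * m) * e"
      using e lam' by (intro mult_right_mono) (auto simp: q_def m_def algebra_simps)
    finally have B1: "B (Suc j) \<le> q * (m * e)" by (simp add: mult_ac)
    have Bj: "B j \<le> 1"
    proof -
      have "q * e * 1 \<le> q * e * m" using m q e by (intro mult_left_mono) auto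
      then show ?thesis using IH(2) qe by (simp add: mult_ac)
    qed
    have "A (Suc j) * (B (Suc j) + B j) \<le> A (Suc j) * 2"
      using B1 qe Bj nn by (intro mult_left_mono) auto
    then have "A (Suc (Suc j)) \<le> (2 * lam + 6) * A (Suc j) + 2 / lam * (B (Suc j) + B j) + A j"
      using Astep[OF Suc.prems] by (simp add: algebra_simps)
    also have "(2 * lam + 6) * A (Suc j) \<le> (2 * lam + 6) * (m * e)"
      using IH(3) lam' by (intro mult_left_mono) auto
    also have "2 / lam * (B (Suc j) + B j) \<le> 2 / lam * (q * (m * e) + q * e)"
      using B1 IH(2) lam' by (intro mult_left_mono) auto
    also have "2 / lam * (q * (m * e) + q * e) = 2 * q / lam * (m * e + e)"
      by (simp add: algebra_simps add_divide_distrib)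
    also have "\<dots> \<le> 4 * (m * e + e)"
      using lam' e m by (intro mult_right_mono) (auto simp: q_def divide_simps)
    also have "A j \<le> e" by (rule IH)
    also have "(2 * lam + 6) * (m * e) + 4 * (m * e + e) + e = ((2 * lam + 10) * m + 5) * e"
      by (simp add: algebra_simps)
    also have "\<dots> \<le> (m * m) * e"
      using e m by (intro mult_right_mono) (auto simp: m_def algebra_simps)
    finally have "A (Suc (Suc j)) \<le> m * (m * e)" by (simp add: mult_ac)
    with IH B1 show ?case by (simp add: e_def mult_ac)
  qed
  have A1: "A j \<le> 1" "B j \<le> 1" if "j \<le> k" for j
  proof -
    have "1 * (\<epsilon> * m ^ j) \<le> q * (\<epsilon> * m ^ j)" using q eps m by (intro mult_right_mono) auto
    with sm[OF that] main[OF that] show "A j \<le> 1" "B j \<le> 1" by (auto simp: mult_ac)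
  qed
  show ?thesis
  proof (rule that[OF E])
    fix n assume n: "n \<le> 2 * k + 1"
    have tri: "cmod (y n) \<le> cmod (x n) + cmod (y n - x n)"
      using norm_triangle_ineq[of "x n" "y n - x n"] by simp
    show "cmod (trace_seq (of_real lam) (Complex E \<epsilon>) n) \<le> lam + 3"
    proof (cases "even n")
      case True
      then obtain j where j: "n = 2 * j" by blast
      then have jk: "j \<le> k" using n by simp
      have "cmod (x n) \<le> 2"
        using aE[of j] jk by (cases "j = 0") (auto simp: x_def j)
      with tri A1(1)[OF jk] lam' show ?thesis by (auto simp: j A_def y_def z_def)
    next
      case False
      then obtain j where j: "n = 2 * j + 1" by (elim oddE)
      then have jk: "j \<le> k" using n by simp
      have "cmod (x n) \<le> lam + 2"
        using bE[of j] jk lam' by (auto simp: x_def j)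
      with tri A1(2)[OF jk] show ?thesis by (auto simp: j B_def y_def z_def)
    qed
  qed
qed

section \<open>Squares in the Fibonacci sequence\<close>

abbreviation (input) \<omega> :: real where "\<omega> \<equiv> inverse golden"

lemma golden_pos: "0 < golden" by (simp add: golden_def add_pos_pos)

lemma golden_gt_1: "1 < golden"
proof -
  have "sqrt 1 < sqrt 5" by (subst real_sqrt_less_iff) simp
  then show ?thesis by (simp add: golden_def)
qed

lemma golden_square: "golden\<^sup>2 = golden + 1"
  by (simp add: golden_def power2_eq_square algebra_simps)

lemma omega_pos: "0 < \<omega>" using golden_pos by simp

lemma omega_lt_1: "\<omega> < 1" using golden_gt_1 by (simp add: inverse_less_1_iff)

lemma omega_square: "\<omega>\<^sup>2 = 1 - \<omega>"
proof -
  have "golden * golden = golden + 1" using golden_square by (simp add: power2_eq_square)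
  then have "\<omega>\<^sup>2 * golden\<^sup>2 = (1 - \<omega>) * golden\<^sup>2"
    using golden_pos by (simp add: power2_eq_square field_simps)
  then show ?thesis using golden_pos by simp
qed

lemma omega_power: "\<omega> ^ (k + 2) = \<omega> ^ k - \<omega> ^ (k + 1)"
  unfolding power_add omega_square by (simp add: algebra_simps)

definition fib_word :: "real \<Rightarrow> int \<Rightarrow> int" where
  "fib_word \<theta> n = \<lfloor>of_int (n + 1) * \<omega> + \<theta>\<rfloor> - \<lfloor>of_int n * \<omega> + \<theta>\<rfloor>"

text \<open>The fractional part lies in the last interval of length \<omega> exactly when adding
  \<omega> carries the floor to the next integer.\<close>

lemma fib_potential_eq: "fib_potential lam \<theta> n = lam * of_int (fib_word \<theta> n)"
proof -
  define x where "x = of_int n * \<omega> + \<theta>"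
  have "of_int (\<lfloor>x + \<omega>\<rfloor> - \<lfloor>x\<rfloor>) = indicat_real {1 - \<omega>..<1} (frac x)"
  proof (cases "frac x + \<omega> < 1")
    case True
    have "\<lfloor>x + \<omega>\<rfloor> = \<lfloor>x\<rfloor>"
      using True omega_pos frac_ge_0[of x] unfolding frac_def by (intro floor_unique) linarith+
    then show ?thesis using True by (simp add: indicator_def)
  next
    case False
    have "\<lfloor>x + \<omega>\<rfloor> = \<lfloor>x\<rfloor> + 1"
      using False omega_lt_1 frac_lt_1[of x] unfolding frac_def by (intro floor_unique) (simp; linarith)+
    then show ?thesis using False frac_lt_1[of x] by (simp add: indicator_def)
  qed
  then show ?thesis
    unfolding fib_potential_def fib_word_def x_def by (simp add: algebra_simps)
qed

text \<open>Reflecting the rotation exchanges floor and ceiling, which on a finite window amounts to an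
  infinitesimal change of the phase.\<close>

lemma fib_word_reflect:
  obtains \<theta>' where "\<And>n. \<bar>n\<bar> \<le> R \<Longrightarrow> fib_word \<theta> (- n) = fib_word \<theta>' n"
proof -
  define g where "g n = of_int n * \<omega> - \<theta>" for n :: int
  \<comment> \<open>The gap between \<open>g n\<close> and the largest integer strictly below it is
    positive, so the smallest gap is an admissible shift \<eta>. The window is one site wider than
    \<open>R\<close> because letters compare neighbouring floors.\<close>
  define F where "F = (\<lambda>n. g n - of_int (\<lceil>g n\<rceil> - 1)) ` {- \<bar>R\<bar> - 1..\<bar>R\<bar> + 1}"
  define \<eta> where "\<eta> = Min F"
  have F: "finite F" "F \<noteq> {}" by (auto simp: F_def)
  have "0 < x" if "x \<in> F" for x
    using that unfolding F_def by (auto simp: less_ceiling_iff) linarith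
  then have \<eta>: "0 < \<eta>" using Min_in[OF F] by (auto simp: \<eta>_def)
  have fl: "\<lfloor>g n - \<eta>\<rfloor> = \<lceil>g n\<rceil> - 1" if "\<bar>n\<bar> \<le> \<bar>R\<bar> + 1" for n
  proof (rule floor_unique)
    have "\<eta> \<le> g n - of_int (\<lceil>g n\<rceil> - 1)"
      unfolding \<eta>_def by (rule Min_le[OF F(1)]) (use that in \<open>force simp: F_def\<close>)
    then show "of_int (\<lceil>g n\<rceil> - 1) \<le> g n - \<eta>" by simp
    show "g n - \<eta> < of_int (\<lceil>g n\<rceil> - 1) + 1"
      using \<eta> le_of_int_ceiling[of "g n"] by linarith
  qed
  show ?thesis
  proof (rule that)
    fix n :: int assume n: "\<bar>n\<bar> \<le> R"
    have "fib_word \<theta> (- n) = \<lfloor>- g (n - 1)\<rfloor> - \<lfloor>- g n\<rfloor>"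
      by (simp add: fib_word_def g_def algebra_simps)
    also have "\<dots> = (\<lceil>g n\<rceil> - 1) - (\<lceil>g (n - 1)\<rceil> - 1)" by (simp add: ceiling_def)
    also have "\<dots> = \<lfloor>g n - \<eta>\<rfloor> - \<lfloor>g (n - 1) - \<eta>\<rfloor>"
      using n fl[of n] fl[of "n - 1"] by simp
    \<comment> \<open>The further shift by \<omega> turns the pair \<open>n - 1\<close>,
      \<open>n\<close> into the pair \<open>n\<close>, \<open>n + 1\<close> of
      \<open>fib_word\<close>.\<close>
    also have "\<dots> = fib_word (- \<theta> - \<eta> - \<omega>) n"
      by (simp add: fib_word_def g_def algebra_simps)
    finally show "fib_word \<theta> (- n) = fib_word (- \<theta> - \<eta> - \<omega>) n" .
  qed
qed

text \<open>The words \<open>s\<^sub>0 = 0\<close>, \<open>s\<^sub>1 = 1\<close>, \<open>s\<^sub>k\<^sub>+\<^sub>2 = s\<^sub>k\<^sub>+\<^sub>1 s\<^sub>k\<close> are represented by their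
  occurrences; the word \<open>s\<^sub>k\<close> has length \<open>fib (k + 1)\<close>.\<close>

fun occurs :: "(int \<Rightarrow> int) \<Rightarrow> nat \<Rightarrow> int \<Rightarrow> bool" where
  "occurs W 0 c \<longleftrightarrow> W c = 0"
| "occurs W (Suc 0) c \<longleftrightarrow> W c = 1"
| "occurs W (Suc (Suc k)) c \<longleftrightarrow> occurs W (Suc k) c \<and> occurs W k (c + int (fib (k + 2)))"

lemma occurs_agree:
  "occurs W k c \<Longrightarrow> occurs W k d \<Longrightarrow> 0 \<le> i \<Longrightarrow> i < int (fib (k + 1)) \<Longrightarrow> W (c + i) = W (d + i)"
proof (induction W k c arbitrary: d i rule: occurs.induct)
  case (3 W k c)
  show ?case
  proof (cases "i < int (fib (k + 2))")
    case True
    then show ?thesis using 3 by simp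
  next
    case False
    then show ?thesis
      using "3.IH"(2)[of "d + int (fib (k + 2))" "i - int (fib (k + 2))"] "3.prems" by simp
  qed
next
  case (1 W c)
  then have "i = 0" by simp
  with 1 show ?case by simp
next
  case (2 W c)
  then have "i = 0" by simp
  with 2 show ?case by simp
qed

text \<open>Each word begins with its predecessor, down to s_1; the word s_1 = 1 does not begin with
  s_0 = 0.\<close>

lemma occurs_prefix: "occurs W k c \<Longrightarrow> 1 \<le> j \<Longrightarrow> j \<le> k \<Longrightarrow> occurs W j c"
proof (induction k)
  case (Suc k)
  then show ?case by (cases k; cases "j = Suc k") auto
qed auto

text \<open>Since \<open>s\<^sub>k s\<^sub>k\<^sub>+\<^sub>1 = s\<^sub>k s\<^sub>k s\<^sub>k\<^sub>-\<^sub>1\<close> and \<open>s\<^sub>k\<close> begins with \<open>s\<^sub>k\<^sub>-\<^sub>1\<close>, it begins with \<open>s\<^sub>k\<^sub>+\<^sub>1\<close>.\<close>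

lemma occurs_merge:
  assumes "2 \<le> k" "occurs W k c" "occurs W (k + 1) (c + int (fib (k + 1)))"
  shows "occurs W (k + 1) c"
proof -
  obtain j where j: "k = Suc j" "1 \<le> j" using assms(1) by (cases k) auto
  have "occurs W j (c + int (fib (k + 1)))"
    using occurs_prefix[OF assms(3), of j] j by simp
  then show ?thesis using assms(2) j by simp
qed

text \<open>In s_i s_i s_j the last word is a prefix of s_i, so the repetition continues for the
  length of s_j.\<close>

lemma three_occurrences_periodic:
  assumes c: "occurs W i c" "occurs W i (c + int (fib (i + 1)))" "occurs W j (c + 2 * int (fib (i + 1)))"
    and j: "1 \<le> j" "j \<le> i" and m: "c \<le> m" "m < c + int (fib (i + 1)) + int (fib (j + 1))"
  shows "W (m + int (fib (i + 1))) = W m"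
proof (cases "m < c + int (fib (i + 1))")
  case True
  then show ?thesis
    using occurs_agree[OF c(1,2), of "m - c"] m by (simp add: add.commute)
next
  case False
  define n where "n = m - c - int (fib (i + 1))"
  have "occurs W j (c + int (fib (i + 1)))" using occurs_prefix[OF c(2) j] .
  from occurs_agree[OF this c(3), of n] show ?thesis
    using False m by (simp add: n_def algebra_simps)
qed

text \<open>With \<open>y = (c - 1)\<omega> + \<theta> - p\<close>, the condition \<open>y \<in> cut_set k\<close> says that \<open>c\<close> starts a block in the
  decomposition of the sequence into blocks \<open>s\<^sub>k\<^sub>+\<^sub>1\<close> and \<open>s\<^sub>k\<close>; the block is \<open>s\<^sub>k\<^sub>+\<^sub>1\<close> if
  \<open>y \<in> cut_set (k + 1)\<close> and \<open>s\<^sub>k\<close> otherwise. Passing the block \<open>s\<^sub>k\<close> adds \<open>(-1)\<^sup>k\<omega>\<^sup>k\<^sup>+\<^sup>1\<close> to \<open>y\<close>.\<close>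

definition cut_set :: "nat \<Rightarrow> real set" where
  "cut_set k = (if even k then {- (\<omega> ^ (k + 1))..<\<omega> ^ (k + 2)} else {- (\<omega> ^ (k + 2))..<\<omega> ^ (k + 1)})"

definition block_shift :: "nat \<Rightarrow> real" where
  "block_shift k = (- 1) ^ k * \<omega> ^ (k + 1)"

text \<open>These are the signed closest returns of the rotation. Both sides satisfy the Fibonacci
  recursion, the right one because of the alternating sign.\<close>

lemma block_shift_eq: "of_int (int (fib (k + 1))) * \<omega> - of_int (int (fib k)) = block_shift k"
proof (induction k rule: induct_nat_012)
  case 0
  show ?case by (simp add: block_shift_def)
next
  case 1
  show ?case using omega_square by (simp add: block_shift_def power2_eq_square)
next
  case (ge2 k)
  have "of_int (int (fib (Suc (Suc k) + 1))) * \<omega> - of_int (int (fib (Suc (Suc k)))) =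
     block_shift (Suc k) + block_shift k"
    unfolding ge2[symmetric] by (simp add: algebra_simps)
  also have "\<dots> = (- 1) ^ k * (\<omega> ^ (k + 1) - \<omega> ^ (k + 2))"
    by (simp add: block_shift_def algebra_simps)
  also have "\<dots> = block_shift (Suc (Suc k))"
    using omega_power[of "k + 1"] by (simp add: block_shift_def)
  finally show ?case .
qed

text \<open>With a and b the powers of \<omega> of exponents k + 2 and k + 3, the neighbouring
  powers are a + b and a - b. This reduces the facts below to linear inequalities.\<close>

lemma cut_set_cases:
  obtains a b where "0 < b" "b < a"
    "cut_set k = (if even k then {- a - b..<a} else {- a..<a + b})"
    "cut_set (k + 1) = (if even k then {- b..<a} else {- a..<b})"
    "cut_set (k + 2) = (if even k then {- b..<a - b} else {b - a..<b})"
    "block_shift k = (if even k then a + b else - a - b)"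
    "block_shift (k + 1) = (if even k then - a else a)"
proof -
  define a where "a = \<omega> ^ Suc (Suc k)"
  define b where "b = \<omega> ^ Suc (Suc (Suc k))"
  have pow: "\<omega> ^ Suc k = a + b" "\<omega> ^ Suc (Suc k) = a" "\<omega> ^ Suc (Suc (Suc k)) = b"
    "\<omega> ^ Suc (Suc (Suc (Suc k))) = a - b"
    using omega_power[of "k + 1"] omega_power[of "k + 2"] by (simp_all add: a_def b_def del: power_Suc)
  have "b < a" using pow(4) omega_pos zero_less_power[of \<omega> "Suc (Suc (Suc (Suc k)))"] by linarith
  moreover have "0 < b" unfolding b_def using omega_pos by (rule zero_less_power)
  moreover have "(- 1) ^ Suc k = (if even k then - 1 else 1 :: real)" by simp
  ultimately show ?thesis
    by (intro that[of b a]) (auto simp: cut_set_def block_shift_def pow simp del: power_Suc)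
qed

lemma cut_set_antimono: "y \<in> cut_set (k + 1) \<Longrightarrow> y \<in> cut_set k"
  by (rule cut_set_cases[of k]) (auto split: if_splits)

lemma cut_set_next_long: "y \<in> cut_set (k + 1) \<Longrightarrow> y + block_shift (k + 1) \<in> cut_set k"
  by (rule cut_set_cases[of k]) (auto split: if_splits)

text \<open>Two short blocks never follow one another.\<close>

lemma cut_set_next_short:
  "y \<in> cut_set k \<Longrightarrow> y \<notin> cut_set (k + 1) \<Longrightarrow> y + block_shift k \<in> cut_set (k + 1)"
  by (rule cut_set_cases[of k]) (auto split: if_splits)

text \<open>The rule s_{k+2} = s_{k+1} s_k for cuts. The converse direction expresses that every
  short block is preceded by a long one.\<close>

lemma cut_set_refine:
  "y \<in> cut_set (k + 2) \<longleftrightarrow> y + block_shift (k + 1) \<in> cut_set k \<and> y + block_shift (k + 1) \<notin> cut_set (k + 1)"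
  by (rule cut_set_cases[of k]) (auto split: if_splits)


text \<open>The integer \<open>p\<close> chooses the representative modulo 1, which avoids
  fractional parts: passing the block s_k raises \<open>p\<close> by \<open>fib k\<close>.\<close>

definition rot :: "real \<Rightarrow> int \<Rightarrow> int \<Rightarrow> real" where
  "rot \<theta> p c = of_int (c - 1) * \<omega> + \<theta> - of_int p"

lemma rot_add_fib:
  "rot \<theta> (p + int (fib k)) (c + int (fib (k + 1))) = rot \<theta> p c + block_shift k"
  unfolding block_shift_eq[symmetric] rot_def by (simp add: algebra_simps)

lemma rot_diff_fib:
  "rot \<theta> (p - int (fib k)) (c - int (fib (k + 1))) = rot \<theta> p c - block_shift k"
  unfolding block_shift_eq[symmetric] rot_def by (simp add: algebra_simps)

lemma fib_word_rot: "fib_word \<theta> c = \<lfloor>rot \<theta> p c + 2 * \<omega>\<rfloor> - \<lfloor>rot \<theta> p c + \<omega>\<rfloor>"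
proof -
  have "rot \<theta> p c + 2 * \<omega> = of_int (c + 1) * \<omega> + \<theta> - of_int p"
    "rot \<theta> p c + \<omega> = of_int c * \<omega> + \<theta> - of_int p"
    by (simp_all add: rot_def algebra_simps)
  then show ?thesis by (simp only: floor_diff_of_int fib_word_def)
qed

lemma omega_cube: "\<omega> ^ 3 = 2 * \<omega> - 1"
proof -
  have "\<omega> ^ 3 = \<omega> ^ 1 - \<omega> ^ 2"
    using omega_power[of 1] by (simp add: numeral_eq_Suc del: power_Suc)
  then show ?thesis using omega_square by simp
qed

text \<open>For y in [-\<omega>, 1 - \<omega>), which is \<open>cut_set 0\<close>, the floor of y +
  \<omega> is 0, and y + 2\<omega> reaches 1 precisely from 1 - 2\<omega> on, which is where
  \<open>cut_set 1\<close> begins.\<close>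

lemma fib_word_letter:
  "rot \<theta> p c \<in> cut_set 1 \<Longrightarrow> fib_word \<theta> c = 1"
  "rot \<theta> p c \<in> cut_set 0 \<Longrightarrow> rot \<theta> p c \<notin> cut_set 1 \<Longrightarrow> fib_word \<theta> c = 0"
proof -
  define y where "y = rot \<theta> p c"
  have cube: "\<omega> * (\<omega> * \<omega>) = 2 * \<omega> - 1" and sq: "\<omega> * \<omega> = 1 - \<omega>"
    using omega_cube omega_square by (simp_all only: power2_eq_square power3_eq_cube mult.assoc)
  have "0 < \<omega> * (\<omega> * \<omega>)" using golden_pos by simp
  then have w: "1 < 2 * \<omega>" "\<omega> < 1" using cube omega_lt_1 by linarith+
  have cuts: "cut_set 1 = {1 - 2 * \<omega>..<1 - \<omega>}" "cut_set 0 = {- \<omega>..<1 - \<omega>}"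
    unfolding cut_set_def using cube sq by (simp_all add: eval_nat_numeral)
  { assume y: "y \<in> cut_set 1"
    have "\<lfloor>y + 2 * \<omega>\<rfloor> = 1" "\<lfloor>y + \<omega>\<rfloor> = 0"
      using y w unfolding cuts by (auto intro!: floor_unique)
    then show "fib_word \<theta> c = 1" using fib_word_rot[of \<theta> c p] by (simp add: y_def) }
  { assume y: "y \<in> cut_set 0" "y \<notin> cut_set 1"
    have "\<lfloor>y + 2 * \<omega>\<rfloor> = 0" "\<lfloor>y + \<omega>\<rfloor> = 0"
      using y w unfolding cuts by (auto intro!: floor_unique)
    then show "fib_word \<theta> c = 0" using fib_word_rot[of \<theta> c p] by (simp add: y_def) }
qed

text \<open>Long and short blocks are treated together: a long block s_{k+1} starts with s_k, and by
  \<open>cut_set_refine\<close> a short block of level k - 1 follows, completing s_k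
  s_{k-1}.\<close>

lemma cut_set_occurs_aux:
  "(rot \<theta> p c \<in> cut_set (k + 1) \<longrightarrow> occurs (fib_word \<theta>) (k + 1) c) \<and>
   (rot \<theta> p c \<in> cut_set k \<longrightarrow> rot \<theta> p c \<notin> cut_set (k + 1) \<longrightarrow> occurs (fib_word \<theta>) k c)"
proof (induction k arbitrary: p c rule: less_induct)
  case (less k)
  consider "k = 0" | j where "k = Suc j" by (cases k) auto
  then show ?case
  proof cases
    case 1
    then show ?thesis using fib_word_letter[of \<theta> p c] by simp
  next
    case 2
    have prev: "occurs (fib_word \<theta>) k c" if "rot \<theta> p c \<in> cut_set k"
      using less[of j p c] that 2 by simp
    moreover have "occurs (fib_word \<theta>) (k + 1) c" if y: "rot \<theta> p c \<in> cut_set (k + 1)"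
    proof -
      have "rot \<theta> (p + int (fib k)) (c + int (fib (k + 1))) \<in> cut_set j
        \<and> rot \<theta> (p + int (fib k)) (c + int (fib (k + 1))) \<notin> cut_set (j + 1)"
        unfolding rot_add_fib using cut_set_refine[of "rot \<theta> p c" j] y 2 by simp
      then have "occurs (fib_word \<theta>) j (c + int (fib (k + 1)))"
        using less[of j] 2 by blast
      then show ?thesis using prev[OF cut_set_antimono] y 2 by simp
    qed
    ultimately show ?thesis by blast
  qed
qed

lemma cut_set_occurs:
  assumes y: "rot \<theta> p c \<in> cut_set k" and k: "1 \<le> k"
  shows "occurs (fib_word \<theta>) k c"
  using cut_set_occurs_aux[of \<theta> p c "k - 1"] y k by simp

text \<open>Even a short block s_k starts an occurrence of s_{k+1}: the next block is long, and s_k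
  s_{k+1} begins with s_{k+1}.\<close>

lemma cut_set_occurs_Suc:
  assumes y: "rot \<theta> p c \<in> cut_set k" and k: "2 \<le> k"
  shows "occurs (fib_word \<theta>) (k + 1) c"
proof (cases "rot \<theta> p c \<in> cut_set (k + 1)")
  case True
  then show ?thesis by (rule cut_set_occurs) simp
next
  case False
  have "rot \<theta> (p + int (fib k)) (c + int (fib (k + 1))) \<in> cut_set (k + 1)"
    unfolding rot_add_fib using cut_set_next_short[OF y False] .
  then show ?thesis
    using occurs_merge[OF k cut_set_occurs[OF y]] cut_set_occurs k by auto
qed

section \<open>Squares at arbitrary sites\<close>

text \<open>Every site is a cut of level 0. Passing to the next level keeps a long block in place
  and joins a short one to the long block before it.\<close>

lemma block_containing:
  obtains c p where "rot \<theta> p c \<in> cut_set k" "c \<le> n"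
    "n < c + int (fib (if rot \<theta> p c \<in> cut_set (k + 1) then k + 2 else k + 1))"
proof -
  have "\<exists>c p. rot \<theta> p c \<in> cut_set k \<and> c \<le> n \<and>
    n < c + int (fib (if rot \<theta> p c \<in> cut_set (k + 1) then k + 2 else k + 1))"
  proof (induction k)
    case 0
    define p where "p = \<lfloor>of_int (n - 1) * \<omega> + \<theta> + \<omega>\<rfloor>"
    have "cut_set 0 = {- \<omega>..<1 - \<omega>}"
      unfolding cut_set_def using omega_square by (simp add: power2_eq_square)
    then have "rot \<theta> p n \<in> cut_set 0"
      unfolding rot_def p_def by auto linarith+
    then show ?case by (intro exI[of _ n] exI[of _ p]) simp
  next
    case (Suc k)
    then obtain c p where y: "rot \<theta> p c \<in> cut_set k" and c: "c \<le> n"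
      "n < c + int (fib (if rot \<theta> p c \<in> cut_set (k + 1) then k + 2 else k + 1))" by blast
    show ?case
    proof (cases "rot \<theta> p c \<in> cut_set (k + 1)")
      case True
      then have "n < c + int (fib (k + 2))" using c by simp
      then show ?thesis using True c by (intro exI[of _ c] exI[of _ p]) auto
    next
      case False
      have "rot \<theta> (p - int (fib (k + 1))) (c - int (fib (k + 2))) \<in> cut_set (k + 2)"
        using rot_diff_fib[of \<theta> p "k + 1" c] cut_set_refine[of "rot \<theta> p c - block_shift (k + 1)" k] y False
        by simp
      moreover from cut_set_antimono[of _ "k + 1"] this
      have "rot \<theta> (p - int (fib (k + 1))) (c - int (fib (k + 2))) \<in> cut_set (k + 1)" by simp
      ultimately show ?thesis
        using False c by (intro exI[of _ "c - int (fib (k + 2))"] exI[of _ "p - int (fib (k + 1))"]) simp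
    qed
  qed
  then show ?thesis using that by blast
qed

lemma square_at_block:
  assumes "occurs W i c" "occurs W i (c + int (fib (i + 1)))" "occurs W j (c + 2 * int (fib (i + 1)))"
    and "1 \<le> j" "j \<le> i" and "c \<le> n" "n \<le> c + int (fib (j + 1))"
  shows "occurs W i c \<and> c \<le> n \<and> (\<forall>m\<in>{c..<n + int (fib (i + 1))}. W (m + int (fib (i + 1))) = W m)"
  using three_occurrences_periodic[OF assms(1-5)] assms by auto

text \<open>A square starts at \<open>n\<close>, and its period is a conjugate of \<open>s\<^sub>i\<close> because the periodicity
  reaches back to an occurrence of \<open>s\<^sub>i\<close> at \<open>c\<close>.\<close>

lemma square_at_site:
  assumes k: "5 \<le> k"
  obtains i c where "k - 1 \<le> i" "i \<le> k + 2" "occurs (fib_word \<theta>) i c" "c \<le> n"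
    "\<And>m. c \<le> m \<Longrightarrow> m < n + int (fib (i + 1)) \<Longrightarrow>
       fib_word \<theta> (m + int (fib (i + 1))) = fib_word \<theta> m"
proof -
  note found = that
  define W where "W = fib_word \<theta>"
  define f where "f i = int (fib (i + 1))" for i
  have f: "f (i + 2) = f (i + 1) + f i" for i by (simp add: f_def)
  have fk: "f k = f (k - 1) + f (k - 2)" "f (k + 1) = f k + f (k - 1)" "f (k + 2) = f (k + 1) + f k"
  proof -
    have "k - 2 + 2 = k" "k - 2 + 1 = k - 1" "k - 1 + 2 = k + 1" "k - 1 + 1 = k" using k by auto
    then show "f k = f (k - 1) + f (k - 2)" "f (k + 1) = f k + f (k - 1)" "f (k + 2) = f (k + 1) + f k"
      using f[of "k - 2"] f[of "k - 1"] f[of k] by simp_all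
  qed
  define y where "y p c = rot \<theta> p c" for p c
  have step: "y (p + int (fib i)) (c + f i) = y p c + block_shift i" for p c i
    unfolding y_def f_def by (rule rot_add_fib)
  have occ: "occurs W i c" if "y p c \<in> cut_set j" "1 \<le> i" "i \<le> j + 1" "2 \<le> j" for p c i j
    using occurs_prefix[OF cut_set_occurs_Suc, of \<theta> p c j i] that by (simp add: W_def y_def)
  have long: "y (p + int (fib (i + 1))) (c + f (i + 1)) \<in> cut_set i" if "y p c \<in> cut_set (i + 1)" for p c i
    unfolding step using cut_set_next_long[OF that] .
  have short: "y (p + int (fib i)) (c + f i) \<in> cut_set (i + 1)"
    if "y p c \<in> cut_set i" "y p c \<notin> cut_set (i + 1)" for p c i
    unfolding step using cut_set_next_short[OF that] .
  have split: "occurs W i c" "occurs W (i - 1) (c + f i)" if "occurs W (i + 1) c" "1 \<le> i" for i c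
    using that by (cases i; simp add: f_def)+
  have merge: "occurs W i c" if "3 \<le> i" "occurs W (i - 1) c" "occurs W i (c + f (i - 1))" for i c
    using occurs_merge[of "i - 1" W c] that by (simp add: f_def)
  obtain c p where yc: "y p c \<in> cut_set k" and cn: "c \<le> n"
    and nc: "n < c + int (fib (if y p c \<in> cut_set (k + 1) then k + 2 else k + 1))"
    using block_containing[of \<theta> k n] unfolding y_def by blast
  have goal: thesis if "k - 1 \<le> i" "i \<le> k + 2" "occurs W i c" "occurs W i (c + f i)" "occurs W j (c + 2 * f i)"
    and "1 \<le> j" "j \<le> i" "c \<le> n" "n \<le> c + f j" for i j c
    using square_at_block[of W i c j n] that k
    by (intro found[of i c]) (auto simp: W_def f_def)
  show thesis
  proof (cases "y p c \<in> cut_set (k + 1)")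
    \<comment> \<open>Blocks s_k, s_{k+1}, then a cut. The tail s_{k-1} of the long block and the
      s_k after it begin with s_k, so there are three copies of s_k.\<close>
    case False
    from short[OF yc False] have d: "y (p + int (fib k)) (c + f k) \<in> cut_set (k + 1)" .
    from long[OF d] have e: "y (p + int (fib k) + int (fib (k + 1))) (c + f k + f (k + 1)) \<in> cut_set k" .
    have "occurs W (k - 1) (c + f k + f k)"
      using split(2)[of k "c + f k"] occ[OF d, of "k + 1"] k by simp
    moreover have "occurs W k (c + f k + f k + f (k - 1))"
      using occ[OF e, of k] k fk by (simp add: add.assoc)
    ultimately have "occurs W k (c + 2 * f k)"
      using merge[of k "c + f k + f k"] k by (simp add: algebra_simps)
    then show thesis
      using goal[of k c k] occ[OF yc, of k] occ[OF d, of k] k cn nc False by (simp add: f_def)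
  next
    case True
    have d: "y (p + int (fib (k + 1))) (c + f (k + 1)) \<in> cut_set k" using long[OF True] .
    show thesis
    proof (cases "y (p + int (fib (k + 1))) (c + f (k + 1)) \<in> cut_set (k + 1)")
      \<comment> \<open>Two long blocks and a further cut, which starts with s_{k+1} again: three
        copies of s_{k+1}.\<close>
      case d': True
      from long[OF d'] have "y (p + int (fib (k + 1)) + int (fib (k + 1))) (c + f (k + 1) + f (k + 1)) \<in> cut_set k" .
      from occ[OF this, of "k + 1"] have "occurs W (k + 1) (c + 2 * f (k + 1))"
        using k by (simp add: algebra_simps)
      then show thesis
        using goal[of "k + 1" c "k + 1"] occ[OF True, of "k + 1"] occ[OF d, of "k + 1"] k cn nc True
        by (simp add: f_def)
    next
      case d': False
      from short[OF d d'] have e: "y (p + int (fib (k + 1)) + int (fib k)) (c + f (k + 1) + f k) \<in> cut_set (k + 1)" .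
      have c2: "y p c \<in> cut_set (k + 2)"
        using cut_set_refine[of "y p c" k] d d' unfolding step by blast
      show thesis
      proof (cases "n < c + f k")
        \<comment> \<open>Here \<open>n\<close> lies in the tail s_{k-1} of the long block. The
          following s_k s_{k+1} continues it to three copies of s_{k-1}.\<close>
        case False
        have 1: "occurs W (k - 1) (c + f k)"
          using split(2)[of k c] occ[OF True, of "k + 1"] k by simp
        have 2: "occurs W (k - 1) (c + f k + f (k - 1))"
          using occ[OF d, of "k - 1"] k fk by (simp add: add.assoc)
        have "occurs W (k - 2) (c + f k + 2 * f (k - 1))"
          using split(2)[of "k - 1" "c + f (k + 1)"] occ[OF d, of k] k fk
          by (simp add: algebra_simps numeral_2_eq_2)
        moreover have "occurs W (k - 1) (c + f k + 2 * f (k - 1) + f (k - 2))"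
          using occ[OF e, of "k - 1"] k fk by (simp add: algebra_simps)
        ultimately have "occurs W (k - 1) (c + f k + 2 * f (k - 1))"
          using merge[of "k - 1" "c + f k + 2 * f (k - 1)"] k by (simp add: numeral_2_eq_2)
        then show thesis
          using goal[of "k - 1" "c + f k" "k - 1"] 1 2 k cn nc True False fk by (simp add: f_def)
      next
        \<comment> \<open>Here \<open>c\<close> starts a block s_{k+2}, and a second copy follows.
          Since \<open>n\<close> is within the length of s_k from \<open>c\<close>, a further s_k
          suffices as the third word.\<close>
        case n: True
        have g: "y (p + int (fib (k + 2))) (c + f (k + 2)) \<in> cut_set (k + 1)"
          using long[of p c "k + 1"] c2 by simp
        have "occurs W k (c + f (k + 2) + f (k + 2))"
        proof (cases "y (p + int (fib (k + 2))) (c + f (k + 2)) \<in> cut_set (k + 2)")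
          case True
          then have "y (p + int (fib (k + 2)) + int (fib (k + 2))) (c + f (k + 2) + f (k + 2)) \<in> cut_set (k + 1)"
            using long[of "p + int (fib (k + 2))" "c + f (k + 2)" "k + 1"] by simp
          from occ[OF this, of k] show ?thesis using k by simp
        next
          \<comment> \<open>The second copy consists of a block s_{k+1} and the beginning s_k of the
            block at \<open>h\<close>. What remains of that block is s_{k-1} s_k, which begins with
            s_k.\<close>
          case False
          define h where "h = c + f (k + 2) + f (k + 1)"
          have h: "occurs W (k + 2) h"
            using occ[OF short[OF g], of "k + 2"] False k by (simp add: h_def add.assoc)
          have "occurs W (k - 1) (h + f k)"
            using split(2)[of k h] split(1)[of "k + 1" h] h k by simp
          moreover have "occurs W k (h + f k + f (k - 1))"
            using split(2)[of "k + 1" h] h k fk by (simp add: add.assoc)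
          ultimately have "occurs W k (h + f k)" using merge[of k "h + f k"] k by simp
          then show ?thesis using fk by (simp add: h_def algebra_simps)
        qed
        then have "occurs W k (c + 2 * f (k + 2))" by (simp add: algebra_simps)
        then show thesis
          using goal[of "k + 2" c k] occ[OF c2, of "k + 2"] occ[OF g, of "k + 2"] k cn n by simp
      qed
    qed
  qed
qed

section \<open>Transfer matrices\<close>

definition step_mat :: "complex \<Rightarrow> complex^2^2" where
  "step_mat e = vector [vector [e, - 1], vector [1, 0]]"

primrec transfer_mat :: "(int \<Rightarrow> complex) \<Rightarrow> int \<Rightarrow> nat \<Rightarrow> complex^2^2" where
  "transfer_mat e c 0 = mat 1"
| "transfer_mat e c (Suc n) = step_mat (e (c + int n)) ** transfer_mat e c n"

text \<open>The factors stand in the opposite order to the words, as later sites multiply from the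
  left.\<close>

fun fib_mat :: "complex \<Rightarrow> complex \<Rightarrow> nat \<Rightarrow> complex^2^2" where
  "fib_mat l z 0 = step_mat z"
| "fib_mat l z (Suc 0) = step_mat (z - l)"
| "fib_mat l z (Suc (Suc k)) = fib_mat l z k ** fib_mat l z (Suc k)"

lemma det_step_mat: "det (step_mat e) = 1"
  by (simp add: step_mat_def det_2)

lemma det_fib_mat: "det (fib_mat l z k) = 1"
  by (induction l z k rule: fib_mat.induct) (auto simp: det_step_mat det_mul)

lemma det_transfer_mat: "det (transfer_mat e c n) = 1"
  by (induction n) (auto simp: det_step_mat det_mul)

lemma trace_2: "trace (A :: 'a::semiring_1^2^2) = A$1$1 + A$2$2"
  by (simp add: trace_def sum_2)

text \<open>By cyclicity this is the trace of A B^2, and B^2 = (trace B) B - 1 by Cayley-Hamilton.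
  It is the source of the trace recursion.\<close>

lemma trace_triple_product:
  fixes A B :: "complex^2^2"
  assumes "det B = 1"
  shows "trace (B ** (A ** B)) = trace B * trace (A ** B) - trace A"
proof -
  have *: "B$1$1 * B$2$2 = 1 + B$1$2 * B$2$1" using assms by (simp add: det_2 algebra_simps)
  show ?thesis
    unfolding trace_2 matrix_matrix_mult_def using * by (simp add: sum_2) algebra
qed

lemma trace_fib_mat: "trace (fib_mat l z k) = trace_seq l z (k + 1)"
proof (induction k rule: less_induct)
  case (less k)
  consider "k = 0" | "k = 1" | "k = 2" | j where "k = Suc (Suc (Suc j))"
    by (metis One_nat_def Suc_1 not0_implies_Suc)
  then show ?case
  proof cases
    case 3
    then show ?thesis
      by (simp add: numeral_2_eq_2 trace_2 matrix_matrix_mult_def sum_2 step_mat_def trace_seq_rec algebra_simps)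
  next
    case 4
    then show ?thesis
      using trace_triple_product[OF det_fib_mat, of l z "Suc j" "fib_mat l z j"]
        less[of j] less[of "Suc j"] less[of "Suc (Suc j)"]
      by (simp add: trace_seq_rec)
  qed (simp_all add: trace_2 step_mat_def)
qed

lemma transfer_mat_add: "transfer_mat e c (m + n) = transfer_mat e (c + int n) m ** transfer_mat e c n"
  by (induction m) (auto simp: matrix_mul_assoc add_ac)

lemma transfer_mat_cong:
  "(\<And>i. i < n \<Longrightarrow> e (c + int i) = e' (c' + int i)) \<Longrightarrow> transfer_mat e c n = transfer_mat e' c' n"
  by (induction n) auto

lemma transfer_mat_occurs:
  "occurs W k c \<Longrightarrow> transfer_mat (\<lambda>n. z - l * of_int (W n)) c (fib (k + 1)) = fib_mat l z k"
proof (induction W k c rule: occurs.induct)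
  case (3 W k c)
  have "fib (Suc (Suc k) + 1) = fib (k + 1) + fib (k + 2)" by simp
  then show ?case using 3 by (simp only: transfer_mat_add) simp
qed (auto)

text \<open>Inside a periodic stretch, moving the window by one site conjugates the product by a
  step matrix.\<close>

lemma trace_transfer_mat_shift:
  assumes "\<And>m. c \<le> m \<Longrightarrow> m < c + int d \<Longrightarrow> e (m + int L) = e m"
  shows "trace (transfer_mat e (c + int d) L) = trace (transfer_mat e c L)"
  using assms
proof (induction d)
  case (Suc d)
  let ?S = "step_mat (e (c + int d))" and ?T = "transfer_mat e (c + int d) L"
    and ?T' = "transfer_mat e (c + int (Suc d)) L"
  have "?S ** ?T = transfer_mat e (c + int d) (Suc L)"
    using Suc.prems[of "c + int d"] by simp
  also have "\<dots> = ?T' ** ?S"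
    using transfer_mat_add[of e "c + int d" L 1] by (simp add: add_ac)
  finally have eq: "?S ** ?T = ?T' ** ?S" .
  obtain R where R: "?S ** R = mat 1" "R ** ?S = mat 1"
    using invertible_det_nz[of ?S] unfolding invertible_def by (auto simp: det_step_mat)
  have "trace ?T' = trace (?T' ** ?S ** R)" by (simp add: R matrix_mul_assoc[symmetric])
  also have "\<dots> = trace (R ** (?S ** ?T))" unfolding eq[symmetric] by (rule trace_mul_sym)
  also have "\<dots> = trace ?T" by (simp add: R matrix_mul_assoc)
  finally show ?case using Suc by simp
qed simp

section \<open>Solutions of the difference equation\<close>

definition state_vec :: "(int \<Rightarrow> complex) \<Rightarrow> int \<Rightarrow> complex^2" where
  "state_vec u n = vector [u (n + 1), u n]"

lemma transfer_mat_state_vec: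
  assumes "\<And>m. 1 \<le> m \<Longrightarrow> m \<le> int n \<Longrightarrow> u (m + 1) = e m * u m - u (m - 1)"
  shows "transfer_mat e 1 n *v state_vec u 0 = state_vec u (int n)"
  using assms
proof (induction n)
  case (Suc n)
  have "transfer_mat e 1 (Suc n) *v state_vec u 0 = step_mat (e (1 + int n)) *v state_vec u (int n)"
    using Suc by (simp add: matrix_vector_mul_assoc[symmetric])
  also have "\<dots> = state_vec u (int (Suc n))"
    using Suc.prems[of "1 + int n"]
    by (simp add: vec_eq_iff forall_2 matrix_vector_mult_def sum_2 step_mat_def state_vec_def add_ac)
  finally show ?case .
qed simp

lemma cayley_hamilton_vec:
  fixes A :: "complex^2^2"
  assumes "det A = 1"
  shows "A *v (A *v v) = trace A *s (A *v v) - v"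
proof -
  have "A$1$1 * A$2$2 = 1 + A$1$2 * A$2$1" using assms by (simp add: det_2 algebra_simps)
  then show ?thesis
    by (simp add: vec_eq_iff forall_2 matrix_vector_mult_def sum_2 trace_2) algebra
qed

text \<open>By Cayley--Hamilton a solution cannot be small at both ends of a square.\<close>

lemma solution_at_square:
  fixes z l :: complex and u :: "int \<Rightarrow> complex"
  assumes k: "5 \<le> k"
    and u: "\<And>m. 1 \<le> m \<Longrightarrow> m \<le> 2 * int (fib (k + 3)) \<Longrightarrow>
              u (m + 1) = (z - l * of_int (fib_word \<theta> m)) * u m - u (m - 1)"
  obtains i where "k - 1 \<le> i" "i \<le> k + 2"
    "u 0 = trace_seq l z (i + 1) * u (int (fib (i + 1))) - u (2 * int (fib (i + 1)))"
    "u 1 = trace_seq l z (i + 1) * u (int (fib (i + 1)) + 1) - u (2 * int (fib (i + 1)) + 1)"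
proof -
  define e where "e m = z - l * of_int (fib_word \<theta> m)" for m
  obtain i c where i: "k - 1 \<le> i" "i \<le> k + 2" and c: "occurs (fib_word \<theta>) i c" "c \<le> 1"
    and per: "\<And>m. c \<le> m \<Longrightarrow> m < 1 + int (fib (i + 1)) \<Longrightarrow>
       fib_word \<theta> (m + int (fib (i + 1))) = fib_word \<theta> m"
    using square_at_site[OF k, of \<theta> 1] by blast
  define L where "L = fib (i + 1)"
  have L: "L \<le> fib (k + 3)" unfolding L_def using i by (intro fib_mono) simp
  define M where "M = transfer_mat e 1 L"
  \<comment> \<open>The square begins at site 1, but the trace is known at \<open>c\<close>, where
    s_i occurs; periodicity transports it.\<close>
  have "trace M = trace (transfer_mat e (c + int (nat (1 - c))) L)" using c by (simp add: M_def)
  also have "\<dots> = trace (transfer_mat e c L)"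
    by (rule trace_transfer_mat_shift) (use per c in \<open>auto simp: e_def L_def\<close>)
  also have "\<dots> = trace_seq l z (i + 1)"
    unfolding L_def e_def transfer_mat_occurs[OF c(1)] by (rule trace_fib_mat)
  finally have tr: "trace M = trace_seq l z (i + 1)" .
  have 1: "M *v state_vec u 0 = state_vec u (int L)"
    unfolding M_def by (rule transfer_mat_state_vec) (use u L in \<open>auto simp: e_def\<close>)
  have "transfer_mat e 1 (L + L) *v state_vec u 0 = state_vec u (int (L + L))"
    by (rule transfer_mat_state_vec) (use u L in \<open>auto simp: e_def\<close>)
  moreover have "transfer_mat e (1 + int L) L = M"
    unfolding M_def
  proof (rule transfer_mat_cong)
    fix i assume "i < L"
    then show "e (1 + int L + int i) = e (1 + int i)"
      using per[of "1 + int i"] c by (simp add: e_def L_def add_ac)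
  qed
  ultimately have "M *v (M *v state_vec u 0) = state_vec u (2 * int L)"
    by (simp add: transfer_mat_add matrix_vector_mul_assoc M_def)
  then have "state_vec u (2 * int L) = trace_seq l z (i + 1) *s state_vec u (int L) - state_vec u 0"
    using cayley_hamilton_vec[OF det_transfer_mat, of e 1 L "state_vec u 0"] 1 tr by (simp add: M_def)
  then have "u 0 = trace_seq l z (i + 1) * u (int L) - u (2 * int L)"
    "u 1 = trace_seq l z (i + 1) * u (int L + 1) - u (2 * int L + 1)"
    by (auto simp: vec_eq_iff forall_2 state_vec_def)
  then show ?thesis using that[OF i] by (simp add: L_def)
qed

section \<open>Evolution and resolvent\<close>

text \<open>Termwise differentiation; the differentiated series converges uniformly on a bounded
  interval around \<open>t\<close> by the Weierstrass test.\<close>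

lemma exp_series_has_vector_derivative:
  fixes w :: "nat \<Rightarrow> 'a::banach"
  assumes w: "\<And>k. norm (w k) \<le> M * K ^ k" and M: "0 \<le> M"
  shows "((\<lambda>t. \<Sum>k. (t ^ k / fact k) *\<^sub>R w k) has_vector_derivative
           (\<Sum>k. (t ^ k / fact k) *\<^sub>R w (Suc k))) (at t)"
proof -
  define S where "S = {- (\<bar>t\<bar> + 1)<..<\<bar>t\<bar> + 1}"
  define R where "R = \<bar>t\<bar> + 1"
  define f where "f k s = (s ^ k / fact k) *\<^sub>R w k" for k and s :: real
  define f' where "f' k s h = h *\<^sub>R ((of_nat k * s ^ (k - 1) / fact k) *\<^sub>R w k)" for k and s h :: real
  define G where "G s = (\<Sum>k. (s ^ k / fact k) *\<^sub>R w (Suc k))" for s :: real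
  have smle: "\<bar>s ^ k / fact k\<bar> * c \<le> R ^ k / fact k * c" if "s \<in> S" "0 \<le> c" for s c :: real and k
    using that power_mono[of "\<bar>s\<bar>" R k] unfolding S_def R_def
    by (intro mult_right_mono) (auto simp: power_abs intro!: divide_right_mono)
  have summ: "summable (\<lambda>k. R ^ k / fact k * (M' * K ^ k))" for M'
    using summable_mult[OF summable_exp_generic[of "R * K"], of M']
    by (simp add: field_simps power_mult_distrib)
  have bnd: "norm ((s ^ k / fact k) *\<^sub>R w (Suc k)) \<le> R ^ k / fact k * (M * K * K ^ k)" if "s \<in> S" for s k
  proof -
    have "norm ((s ^ k / fact k) *\<^sub>R w (Suc k)) \<le> R ^ k / fact k * norm (w (Suc k))"
      using smle[OF that, of "norm (w (Suc k))" k] by simp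
    also have "\<dots> \<le> R ^ k / fact k * (M * K * K ^ k)"
      using w[of "Suc k"] by (intro mult_left_mono) (auto simp: R_def mult_ac)
    finally show ?thesis .
  qed
  have ul: "uniform_limit S (\<lambda>n s. \<Sum>k<n. (s ^ k / fact k) *\<^sub>R w (Suc k)) G sequentially"
    unfolding G_def by (rule Weierstrass_m_test[OF bnd summ])
  have shift: "(\<Sum>k<Suc n. f' k s h) = h *\<^sub>R (\<Sum>k<n. (s ^ k / fact k) *\<^sub>R w (Suc k))" for n s h
  proof -
    have "real (Suc k) * s ^ k / fact (Suc k) = s ^ k / fact k" for k
      by (simp add: divide_simps del: of_nat_Suc)
    then have "f' (Suc k) s h = h *\<^sub>R ((s ^ k / fact k) *\<^sub>R w (Suc k))" for k
      unfolding f'_def by simp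
    then show ?thesis
      unfolding sum.lessThan_Suc_shift scaleR_right.sum by (simp add: f'_def)
  qed
  have "\<exists>g. \<forall>s\<in>S. (\<lambda>n. f n s) sums g s \<and> (g has_derivative (\<lambda>h. h *\<^sub>R G s)) (at s within S)"
  proof (rule has_derivative_series)
    show "convex S" "t \<in> S" by (auto simp: S_def)
    show "(f n has_derivative f' n s) (at s within S)" for n s
      unfolding f_def f'_def
      by (auto intro!: derivative_eq_intros simp: fun_eq_iff)
    show "(\<lambda>n. f n t) sums (\<Sum>n. f n t)"
    proof (rule summable_sums, rule summable_comparison_test', rule summ[of M])
      fix k
      have "t \<in> S" by (auto simp: S_def)
      from smle[OF this, of "norm (w k)" k] have "norm (f k t) \<le> R ^ k / fact k * norm (w k)"
        by (simp add: f_def)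
      also have "\<dots> \<le> R ^ k / fact k * (M * K ^ k)"
        using w[of k] by (intro mult_left_mono) (auto simp: R_def)
      finally show "norm (f k t) \<le> R ^ k / fact k * (M * K ^ k)" .
    qed
    fix e :: real assume e: "0 < e"
    have "\<forall>\<^sub>F n in sequentially. \<forall>s\<in>S. dist (\<Sum>k<n. (s ^ k / fact k) *\<^sub>R w (Suc k)) (G s) < e"
      using ul e by (rule uniform_limitD)
    then have "\<forall>\<^sub>F n in sequentially. \<forall>s\<in>S. \<forall>h. norm ((\<Sum>k<Suc n. f' k s h) - h *\<^sub>R G s) \<le> e * norm h"
    proof eventually_elim
      case (elim n)
      show ?case
      proof (intro ballI allI)
        fix s h assume "s \<in> S"
        have "norm ((\<Sum>k<Suc n. f' k s h) - h *\<^sub>R G s) =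
            \<bar>h\<bar> * dist (\<Sum>k<n. (s ^ k / fact k) *\<^sub>R w (Suc k)) (G s)"
          unfolding shift dist_norm by (simp flip: scaleR_diff_right)
        also have "\<dots> \<le> \<bar>h\<bar> * e" using elim \<open>s \<in> S\<close> by (intro mult_left_mono) auto
        finally show "norm ((\<Sum>k<Suc n. f' k s h) - h *\<^sub>R G s) \<le> e * norm h"
          by (simp add: mult.commute)
      qed
    qed
    then show "\<forall>\<^sub>F n in sequentially. \<forall>s\<in>S. \<forall>h. norm ((\<Sum>k<n. f' k s h) - h *\<^sub>R G s) \<le> e * norm h"
      by (subst (asm) eventually_sequentially_Suc)
  qed
  then obtain g where g: "\<And>s. s \<in> S \<Longrightarrow> (\<lambda>n. f n s) sums g s"
    "\<And>s. s \<in> S \<Longrightarrow> (g has_derivative (\<lambda>h. h *\<^sub>R G s)) (at s within S)" by blast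
  have tS: "t \<in> S" "open S" by (auto simp: S_def)
  have "(g has_derivative (\<lambda>h. h *\<^sub>R G t)) (at t)"
    using g(2)[OF tS(1)] unfolding at_within_open[OF tS] .
  then have "((\<lambda>s. \<Sum>n. f n s) has_derivative (\<lambda>h. h *\<^sub>R G t)) (at t)"
    by (rule has_derivative_transform_within_open[OF _ tS(2,1)]) (rule sums_unique[OF g(1)])
  then show ?thesis
    unfolding has_vector_derivative_def f_def G_def .
qed

lemma bounded_linear_cscale: "bounded_linear (cscale z)"
proof (rule bounded_linear_intro)
  show "cscale z (x + y) = cscale z x + cscale z y" for x y
    by transfer (simp add: algebra_simps)
  show "cscale z (r *\<^sub>R x) = r *\<^sub>R cscale z x" for r x
    by transfer (simp add: algebra_simps)
  show "norm (cscale z x) \<le> norm x * cmod z" for x by (simp add: norm_cscale mult.commute)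
qed

lemma bounded_linear_coord: "bounded_linear (\<lambda>x. coord x n)"
proof (rule bounded_linear_intro)
  show "coord (x + y) n = coord x n + coord y n" for x y by (simp add: plus_l2Z.rep_eq)
  show "coord (r *\<^sub>R x) n = r *\<^sub>R coord x n" for r x
    by (simp add: scaleR_l2Z.rep_eq scaleR_conv_of_real)
  show "norm (coord x n) \<le> norm x * 1" for x using coord_le_norm[of x n] by simp
qed

lemma cscale_cscale: "cscale a (cscale b x) = cscale (a * b) x"
  by transfer (simp add: mult.assoc)

lemma cscale_of_real: "cscale (of_real r) x = r *\<^sub>R x"
  by transfer simp

lemma fib_hamiltonian_cscale:
  "fib_hamiltonian lam \<theta> (cscale z x) = cscale z (fib_hamiltonian lam \<theta> x)"
  by transfer (simp add: algebra_simps)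

text \<open>The infinitesimal form of unitarity. The real potential drops out, and the hopping terms
  are differences of the currents \<open>g\<close> between neighbouring sites, which
  telescope.\<close>

lemma inner_fib_hamiltonian: "inner x (cscale (- \<i>) (fib_hamiltonian lam \<theta> x)) = 0"
proof -
  define g where "g n = Im (coord x n * cnj (coord x (n + 1)))" for n
  have shift: "(\<lambda>n. (cmod (coord x (n + 1)))\<^sup>2) summable_on UNIV"
    by (rule l2_shift) (rule coord_summable)
  have "(\<lambda>n. coord x n * cnj (coord x (n + 1))) summable_on UNIV"
    using l2_product[OF coord_summable shift] by simp
  then have g: "g summable_on UNIV" unfolding g_def by (rule summable_on_Im)
  have g': "(\<lambda>n. g (n - 1)) summable_on UNIV"
    using summable_on_reindex_bij_betw[OF bij_int_shift[of "-1"], of g] g by simp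
  have "Re (coord x n * cnj (coord (cscale (- \<i>) (fib_hamiltonian lam \<theta> x)) n)) = g (n - 1) - g n" for n
    by (simp add: cscale.rep_eq fib_hamiltonian.rep_eq g_def algebra_simps)
  then have "inner x (cscale (- \<i>) (fib_hamiltonian lam \<theta> x)) = (\<Sum>\<^sub>\<infinity>n. g (n - 1) - g n)"
    by (simp only: inner_l2Z_infsum)
  also have "\<dots> = (\<Sum>\<^sub>\<infinity>n. g (n - 1)) - (\<Sum>\<^sub>\<infinity>n. g n)"
    using infsum_add[OF g' summable_on_uminus[THEN iffD2, OF g]] by (simp add: infsum_uminus)
  also have "(\<Sum>\<^sub>\<infinity>n. g (n - 1)) = (\<Sum>\<^sub>\<infinity>n. g n)"
    using infsum_reindex_bij_betw[OF bij_int_shift[of "-1"], of g] by simp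
  finally show ?thesis by simp
qed

context
  fixes lam \<theta> :: real
begin

abbreviation (input) H where "H \<equiv> fib_hamiltonian lam \<theta>"

lemma evolution_term:
  "cscale ((- \<i> * of_real t) ^ k / fact k) x = (t ^ k / fact k) *\<^sub>R cscale ((- \<i>) ^ k) x"
proof -
  have "- \<i> * of_real t = of_real t * (- \<i>)" by simp
  then have "(- \<i> * of_real t) ^ k / fact k = of_real (t ^ k / fact k) * (- \<i>) ^ k"
    by (simp only: power_mult_distrib) simp
  then show ?thesis by (simp only: cscale_cscale[symmetric] cscale_of_real)
qed

lemma evolution_series:
  "evolution H t x = (\<Sum>k. (t ^ k / fact k) *\<^sub>R cscale ((- \<i>) ^ k) ((H ^^ k) x))"
  unfolding evolution_def op_exp_def by (simp only: evolution_term)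

lemma evolution_has_vector_derivative:
  "((\<lambda>t. evolution H t x) has_vector_derivative cscale (- \<i>) (H (evolution H t x))) (at t)"
proof -
  define w where "w k = cscale ((- \<i>) ^ k) ((H ^^ k) x)" for k
  obtain K where K: "0 < K" "\<And>x. norm (H x) \<le> norm x * K"
    using bounded_linear.pos_bounded[OF bounded_linear_fib_hamiltonian] by blast
  have w: "norm (w k) \<le> norm x * K ^ k" for k
  proof -
    have "norm ((H ^^ k) x) \<le> norm x * K ^ k"
    proof (induction k)
      case (Suc k)
      have "norm ((H ^^ Suc k) x) \<le> norm ((H ^^ k) x) * K" using K(2) by simp
      also have "\<dots> \<le> norm x * K ^ k * K" using Suc K(1) by (intro mult_right_mono) auto
      finally show ?case by (simp add: mult_ac)
    qed simp
    then show ?thesis by (simp add: w_def norm_cscale norm_power)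
  qed
  have w_Suc: "w (Suc k) = cscale (- \<i>) (H (w k))" for k
    by (simp add: w_def fib_hamiltonian_cscale cscale_cscale)
  have bl: "bounded_linear (\<lambda>y. cscale (- \<i>) (H y))"
    by (rule bounded_linear_compose[OF bounded_linear_cscale bounded_linear_fib_hamiltonian])
  have "summable (\<lambda>k. cscale ((- \<i> * of_real t) ^ k / fact k) ((H ^^ k) x))"
    by (rule op_exp_summable) (rule bounded_linear_fib_hamiltonian)
  then have summ: "summable (\<lambda>k. (t ^ k / fact k) *\<^sub>R w k)" by (simp only: evolution_term w_def)
  have "(\<Sum>k. (t ^ k / fact k) *\<^sub>R w (Suc k)) = (\<Sum>k. cscale (- \<i>) (H ((t ^ k / fact k) *\<^sub>R w k)))"
    unfolding w_Suc by (simp add: linear_simps(5)[OF bl])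
  also have "\<dots> = cscale (- \<i>) (H (\<Sum>k. (t ^ k / fact k) *\<^sub>R w k))"
    by (rule bounded_linear.suminf[OF bl summ, symmetric])
  finally show ?thesis
    using exp_series_has_vector_derivative[OF w, of t] by (simp add: evolution_series w_def)
qed

lemma evolution_0: "evolution H 0 x = x"
proof -
  have "evolution H 0 x = (\<Sum>k\<in>{0}. (0 ^ k / fact k) *\<^sub>R cscale ((- \<i>) ^ k) ((H ^^ k) x))"
    unfolding evolution_series by (rule suminf_finite) auto
  also have "\<dots> = cscale (of_real 1) x" by simp
  finally show ?thesis by (simp only: cscale_of_real scaleR_one)
qed

lemma norm_evolution: "norm (evolution H t x) = norm x"
proof -
  have "((\<lambda>t. inner (evolution H t x) (evolution H t x)) has_real_derivative 0) (at t)" for t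
  proof -
    have d: "((\<lambda>t. evolution H t x) has_derivative (\<lambda>h. h *\<^sub>R cscale (- \<i>) (H (evolution H t x)))) (at t)"
      using evolution_has_vector_derivative unfolding has_vector_derivative_def .
    from has_derivative_inner[OF d d]
    have "((\<lambda>t. inner (evolution H t x) (evolution H t x)) has_derivative (\<lambda>h. 0)) (at t)"
      using inner_fib_hamiltonian[of "evolution H t x" lam \<theta>]
      by (simp add: inner_commute[of "cscale (- \<i>) (H (evolution H t x))" "evolution H t x"])
    moreover have "(*) (0::real) = (\<lambda>h. 0)" by (simp add: fun_eq_iff)
    ultimately show ?thesis by (simp add: has_field_derivative_def)
  qed
  then have "inner (evolution H t x) (evolution H t x) = inner (evolution H 0 x) (evolution H 0 x)"
    by (intro DERIV_isconst_all) auto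
  then show ?thesis by (simp add: norm_eq_sqrt_inner evolution_0)
qed

definition amplitude :: "int \<Rightarrow> real \<Rightarrow> complex" where
  "amplitude n t = coord (evolution H t (std_basis 0)) n"

lemma site_prob_amplitude: "site_prob H t n = (cmod (amplitude n t))\<^sup>2"
  by (simp add: site_prob_def amplitude_def cinner_std_basis)

lemma amplitude_0: "amplitude n 0 = (if n = 0 then 1 else 0)"
  by (simp add: amplitude_def evolution_0 std_basis.rep_eq)

lemma norm_std_basis: "norm (std_basis k) = 1"
proof -
  have "(norm (std_basis k))\<^sup>2 = Re (cinner (std_basis k) (std_basis k))"
    by (simp add: power2_norm_eq_inner inner_l2Z_def)
  then have "(norm (std_basis k))\<^sup>2 = 1"
    unfolding cinner_std_basis by (simp add: std_basis.rep_eq)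
  then have "(norm (std_basis k))\<^sup>2 = 1\<^sup>2" by simp
  then show ?thesis by (rule power2_eq_imp_eq) auto
qed

lemma cmod_amplitude_le: "cmod (amplitude n t) \<le> 1"
  using coord_le_norm[of "evolution H t (std_basis 0)" n]
  by (simp add: amplitude_def norm_evolution norm_std_basis)

lemma amplitude_has_vector_derivative:
  "(amplitude n has_vector_derivative - \<i> * (amplitude (n + 1) t + amplitude (n - 1) t
     + of_real (fib_potential lam \<theta> n) * amplitude n t)) (at t)"
  using bounded_linear.has_vector_derivative[OF bounded_linear_coord[of n] evolution_has_vector_derivative]
  unfolding amplitude_def[abs_def] by (simp add: cscale.rep_eq fib_hamiltonian.rep_eq)

lemma continuous_amplitude: "continuous_on A (amplitude n)"
  by (meson amplitude_has_vector_derivative continuous_at_imp_continuous_on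
      has_vector_derivative_continuous)

end

section \<open>Laplace transforms in time\<close>

text \<open>Applied to the evolution with \<open>0 < Im z\<close>, this gives i times the inverse of
  z - H.\<close>

definition laplace :: "complex \<Rightarrow> (real \<Rightarrow> complex) \<Rightarrow> complex" where
  "laplace z f = (LINT t:{0<..}|lborel. exp (\<i> * z * of_real t) * f t)"

lemma nn_integral_exp_decay:
  assumes "0 < e"
  shows "(\<integral>\<^sup>+t. ennreal (exp (- e * t)) * indicator {0..} t \<partial>lborel) = ennreal (1 / e)"
proof -
  have "((\<lambda>t. - exp (- e * t) / e) \<longlongrightarrow> - 0 / e) at_top"
  proof (intro tendsto_intros)
    have "filterlim (\<lambda>t. - e * t) at_bot at_top"
      using assms by (intro filterlim_tendsto_neg_mult_at_bot[OF tendsto_const _ filterlim_ident]) auto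
    then show "((\<lambda>t. exp (- e * t)) \<longlongrightarrow> 0) at_top"
      by (rule filterlim_compose[OF exp_at_bot])
  qed (use assms in auto)
  then show ?thesis
    using assms by (subst nn_integral_FTC_atLeast[where F = "\<lambda>t. - exp (- e * t) / e" and T = 0])
      (auto intro!: derivative_eq_intros)
qed

lemma laplace_integrable:
  assumes f: "continuous_on UNIV f" "\<And>t. cmod (f t) \<le> B" and z: "0 < Im z"
  shows "set_integrable lborel {0<..} (\<lambda>t. exp (\<i> * z * of_real t) * f t)"
proof -
  have B: "0 \<le> B" using f(2)[of 0] norm_ge_zero order_trans by blast
  have [measurable]: "f \<in> borel_measurable borel" using f(1) by (rule borel_measurable_continuous_onI)
  have e: "(\<lambda>t. exp (\<i> * z * of_real t)) \<in> borel_measurable borel"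
    by (intro borel_measurable_continuous_onI continuous_intros)
  note [measurable] = e
  have "(\<integral>\<^sup>+t. ennreal (exp (- Im z * t)) * indicator {0..} t \<partial>lborel) < \<infinity>"
    unfolding nn_integral_exp_decay[OF z] by simp
  then have "integrable lborel (\<lambda>t. exp (- Im z * t) * indicator {0..} t)"
    by (intro integrableI_nonneg) (auto simp: ennreal_mult' ennreal_indicator)
  then have "integrable lborel (\<lambda>t. B * (exp (- Im z * t) * indicator {0..} t))"
    by (rule integrable_mult_right)
  then show ?thesis
    unfolding set_integrable_def
  proof (rule Bochner_Integration.integrable_bound)
    show "AE t in lborel. norm (indicat_real {0<..} t *\<^sub>R (exp (\<i> * z * of_real t) * f t))
        \<le> norm (B * (exp (- Im z * t) * indicator {0..} t))"
      using f(2) B by (auto simp: norm_mult indicator_def mult.commute[of B] intro!: AE_I2 mult_left_mono)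
  qed measurable
qed

text \<open>Integration by parts; the boundary term at infinity vanishes because \<open>f\<close> is
  bounded and \<open>Im z\<close> is positive.\<close>

lemma laplace_derivative:
  assumes f: "\<And>t. (f has_vector_derivative f' t) (at t)" "\<And>t. cmod (f t) \<le> B"
    and f': "continuous_on UNIV f'" "\<And>t. cmod (f' t) \<le> B'"
    and z: "0 < Im z"
  shows "laplace z f' = - f 0 - \<i> * z * laplace z f"
proof -
  have cf: "continuous_on UNIV f"
    by (meson f(1) continuous_at_imp_continuous_on has_vector_derivative_continuous)
  have intf: "set_integrable lborel {0<..} (\<lambda>t. exp (\<i> * z * of_real t) * f t)"
    by (rule laplace_integrable[OF cf f(2) z])
  have intf': "set_integrable lborel {0<..} (\<lambda>t. exp (\<i> * z * of_real t) * f' t)"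
    by (rule laplace_integrable[OF f' z])
  have ein: "einterval 0 \<infinity> = {0<..}"
    by (auto simp: einterval_def zero_ereal_def)
  define F where "F t = exp (\<i> * z * of_real t) * f t" for t
  define g where "g t = exp (\<i> * z * of_real t) * f' t + \<i> * z * (exp (\<i> * z * of_real t) * f t)" for t
  have gint: "set_integrable lborel {0<..} g"
    unfolding g_def by (intro set_integral_add intf' set_integrable_mult_right intf)
  have F0: "(F \<longlongrightarrow> f 0) (at_right 0)"
  proof -
    have "continuous_on UNIV F" unfolding F_def by (intro continuous_intros cf)
    then have "isCont F 0" by (simp add: continuous_on_eq_continuous_at)
    then have "(F \<longlongrightarrow> F 0) (at 0)" by (simp add: isCont_def)
    then show ?thesis by (simp add: F_def filterlim_at_split)
  qed
  have Finf: "(F \<longlongrightarrow> 0) at_top"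
  proof (rule Lim_null_comparison)
    have "filterlim (\<lambda>t. - Im z * t) at_bot at_top"
      using z by (intro filterlim_tendsto_neg_mult_at_bot[OF tendsto_const _ filterlim_ident]) auto
    then have "((\<lambda>t. exp (- Im z * t)) \<longlongrightarrow> 0) at_top"
      by (rule filterlim_compose[OF exp_at_bot])
    from tendsto_mult_left[OF this, of B] show "((\<lambda>t. B * exp (- Im z * t)) \<longlongrightarrow> 0) at_top" by simp
    show "\<forall>\<^sub>F t in at_top. norm (F t) \<le> B * exp (- Im z * t)"
      using f(2) by (intro always_eventually) (auto simp: F_def norm_mult mult.commute[of B] intro!: mult_left_mono)
  qed
  have "(LBINT t=0..\<infinity>. g t) = 0 - f 0"
  proof (rule interval_integral_FTC_integrable)
    show "set_integrable lborel (einterval 0 \<infinity>) g" unfolding ein by (rule gint)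
    show "((F \<circ> real_of_ereal) \<longlongrightarrow> f 0) (at_right 0)"
      using F0 unfolding zero_ereal_def ereal_tendsto_simps .
    show "((F \<circ> real_of_ereal) \<longlongrightarrow> 0) (at_left \<infinity>)"
      using Finf unfolding ereal_tendsto_simps .
    fix t :: real
    have "continuous_on UNIV g" unfolding g_def by (intro continuous_intros cf f')
    then show "isCont g t" by (simp add: continuous_on_eq_continuous_at)
    have "((\<lambda>t. exp (\<i> * z * of_real t)) has_vector_derivative \<i> * z * exp (\<i> * z * of_real t)) (at t)"
      by (auto intro!: derivative_eq_intros has_vector_derivative_real_field simp: mult.commute)
    from has_vector_derivative_mult[OF this f(1)] show "(F has_vector_derivative g t) (at t)"
      unfolding F_def g_def by (simp add: algebra_simps)
  qed auto
  moreover have "(LBINT t=0..\<infinity>. g t) = laplace z f' + \<i> * z * laplace z f"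
    unfolding interval_lebesgue_integral_def ein laplace_def g_def
    using intf intf' by (simp add: set_integral_add set_integrable_mult_right)
  ultimately show ?thesis by (simp add: algebra_simps)
qed

text \<open>Cauchy-Schwarz with the exponential weight divided equally between the two factors. For
  \<open>Im z = 2 / T\<close> the remaining weight is that of the time average.\<close>

lemma laplace_bound:
  assumes f: "continuous_on UNIV f" "\<And>t. cmod (f t) \<le> B" and z: "0 < Im z"
  shows "ennreal ((cmod (laplace z f))\<^sup>2) \<le>
    ennreal (1 / Im z) * (\<integral>\<^sup>+t\<in>{0..}. ennreal (exp (- Im z * t)) * ennreal ((cmod (f t))\<^sup>2) \<partial>lborel)"
proof -
  define p where "p t = ennreal (exp (- Im z * t / 2)) * indicator {0..} t" for t
  define q where "q t = ennreal (exp (- Im z * t / 2) * cmod (f t)) * indicator {0..} t" for t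
  have [measurable]: "f \<in> borel_measurable borel" using f(1) by (rule borel_measurable_continuous_onI)
  have [measurable]: "p \<in> borel_measurable lborel" "q \<in> borel_measurable lborel"
    unfolding p_def q_def by measurable
  have ee: "exp (- Im z * t / 2) * exp (- Im z * t / 2) = exp (- Im z * t)" for t
    by (simp flip: exp_add)
  have "ennreal (cmod (laplace z f)) \<le>
      (\<integral>\<^sup>+t. ennreal (norm (indicator {0<..} t *\<^sub>R (exp (\<i> * z * of_real t) * f t))) \<partial>lborel)"
    unfolding laplace_def set_lebesgue_integral_def
    by (rule integral_norm_bound_ennreal)
      (use laplace_integrable[OF f z] in \<open>simp add: set_integrable_def\<close>)
  also have "\<dots> \<le> (\<integral>\<^sup>+t. p t * q t \<partial>lborel)"
  proof (rule nn_integral_mono)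
    fix t :: real
    have "p t * q t = ennreal (exp (- Im z * t / 2) * (exp (- Im z * t / 2) * cmod (f t))) * indicator {0..} t"
      unfolding p_def q_def by (subst ennreal_mult) (auto simp: indicator_def)
    also have "exp (- Im z * t / 2) * (exp (- Im z * t / 2) * cmod (f t)) = exp (- Im z * t) * cmod (f t)"
      unfolding mult.assoc[symmetric] ee ..
    finally show "ennreal (norm (indicator {0<..} t *\<^sub>R (exp (\<i> * z * of_real t) * f t))) \<le> p t * q t"
      by (auto simp: indicator_def norm_mult)
  qed
  finally have "(ennreal (cmod (laplace z f)))\<^sup>2 \<le> (\<integral>\<^sup>+t. p t * q t \<partial>lborel)\<^sup>2"
    by (intro power_mono) auto
  also have "\<dots> \<le> (\<integral>\<^sup>+t. (p t)\<^sup>2 \<partial>lborel) * (\<integral>\<^sup>+t. (q t)\<^sup>2 \<partial>lborel)"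
    by (rule Cauchy_Schwarz_nn_integral) measurable
  also have "(\<lambda>t. (p t)\<^sup>2) = (\<lambda>t. ennreal (exp (- Im z * t)) * indicator {0..} t)"
    unfolding p_def power2_eq_square using ee
    by (auto simp: fun_eq_iff indicator_def simp flip: ennreal_mult)
  also have "(\<lambda>t. (q t)\<^sup>2) = (\<lambda>t. ennreal (exp (- Im z * t)) * ennreal ((cmod (f t))\<^sup>2) * indicator {0..} t)"
  proof
    fix t
    have "(exp (- Im z * t / 2) * cmod (f t))\<^sup>2 = exp (- Im z * t) * (cmod (f t))\<^sup>2"
      using ee[of t] by (simp add: power_mult_distrib power2_eq_square)
    then show "(q t)\<^sup>2 = ennreal (exp (- Im z * t)) * ennreal ((cmod (f t))\<^sup>2) * indicator {0..} t"
      unfolding q_def by (auto simp: indicator_def ennreal_power simp flip: ennreal_mult)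
  qed
  also have "(\<integral>\<^sup>+t. ennreal (exp (- Im z * t)) * indicator {0..} t \<partial>lborel) = ennreal (1 / Im z)"
    by (rule nn_integral_exp_decay[OF z])
  finally show ?thesis by (simp add: ennreal_power)
qed

section \<open>Lower bounds for transport\<close>

text \<open>The Laplace transform of the evolution equation; the source at site 0 comes from the
  initial value.\<close>

lemma resolvent_equation:
  fixes lam \<theta> :: real
  assumes z: "0 < Im z"
  defines "u \<equiv> \<lambda>n. laplace z (amplitude lam \<theta> n)"
  shows "u (n + 1) + u (n - 1) + of_real (fib_potential lam \<theta> n) * u n =
    z * u n - (if n = 0 then \<i> else 0)"
proof -
  define V where "V = complex_of_real (fib_potential lam \<theta> n)"
  define a where "a = amplitude lam \<theta>"
  define f' where "f' t = - \<i> * (a (n + 1) t + a (n - 1) t + V * a n t)" for t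
  have der: "(a n has_vector_derivative f' t) (at t)" for t
    unfolding a_def f'_def V_def by (rule amplitude_has_vector_derivative)
  have cont: "continuous_on UNIV (a m)" for m unfolding a_def by (rule continuous_amplitude)
  have bnd: "cmod (a m t) \<le> 1" for m t unfolding a_def by (rule cmod_amplitude_le)
  have "cmod (f' t) \<le> 1 + 1 + cmod V" for t
  proof -
    have "cmod (f' t) \<le> cmod (a (n + 1) t) + cmod (a (n - 1) t) + cmod (V * a n t)"
      unfolding f'_def norm_mult by (simp add: norm_mult order_trans[OF norm_triangle_ineq] norm_triangle_ineq)
    also have "\<dots> \<le> 1 + 1 + cmod V"
      using bnd[of "n + 1" t] bnd[of "n - 1" t] mult_left_mono[OF bnd[of n t], of "cmod V"]
      unfolding norm_mult by simp
    finally show ?thesis .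
  qed
  moreover have "continuous_on UNIV f'" unfolding f'_def by (intro continuous_intros cont)
  ultimately have "laplace z f' = - a n 0 - \<i> * z * laplace z (a n)"
    using laplace_derivative[OF der bnd _ _ z] by blast
  moreover have "laplace z f' = - \<i> * (u (n + 1) + u (n - 1) + V * u n)"
  proof -
    define E where "E t = exp (\<i> * z * of_real t)" for t
    have int: "set_integrable lborel {0<..} (\<lambda>t. E t * a m t)" for m
      unfolding E_def by (rule laplace_integrable[OF cont bnd z])
    define c where "c = - \<i>"
    have "E t * f' t = c * (E t * a (n + 1) t + E t * a (n - 1) t + V * (E t * a n t))" for t
      unfolding f'_def c_def by (simp add: algebra_simps)
    then have "laplace z f' = (LINT t:{0<..}|lborel. c * (E t * a (n + 1) t + E t * a (n - 1) t + V * (E t * a n t)))"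
      unfolding laplace_def E_def by simp
    then show ?thesis
      using int unfolding u_def laplace_def a_def[symmetric] E_def[symmetric] c_def[symmetric]
      by (simp add: set_integral_add set_integrable_mult_right)
  qed
  ultimately have "\<i> * (- \<i> * (u (n + 1) + u (n - 1) + V * u n)) = \<i> * (- a n 0 - \<i> * z * u n)"
    by (simp add: u_def a_def)
  then show ?thesis
    by (simp add: V_def a_def amplitude_0 algebra_simps split: if_splits)
qed

text \<open>If all far values were below \<delta>, a square on the right would make
  \<open>u 0\<close> and \<open>u 1\<close> small, and a square on the left \<open>u (- 1)\<close>,
  against the equation at site 0.\<close>

lemma resolvent_lower_bound:
  fixes lam \<theta> :: real
  assumes lam: "sqrt 24 < lam" and eps: "0 < \<epsilon>" and k: "4 \<le> k"
    and small: "(lam + 4) * \<epsilon> * (2 * lam + 22) ^ k \<le> 1"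
  obtains z n where "Im z = \<epsilon>" "int (fib (2 * k - 2)) \<le> \<bar>n\<bar>"
    "1 / ((lam + 4) * (2 * lam + 6)) \<le> cmod (laplace z (amplitude lam \<theta> n))"
proof -
  have lam0: "0 < lam" using gt_sqrt_24[OF lam] by simp
  obtain E where E: "lam \<le> E" "E \<le> lam + 2"
    and tr: "\<And>n. n \<le> 2 * k + 1 \<Longrightarrow> cmod (trace_seq (of_real lam) (Complex E \<epsilon>) n) \<le> lam + 3"
    using perturbed_trace_orbit[OF lam _ small] eps by auto
  define z where "z = Complex E \<epsilon>"
  define u where "u n = laplace z (amplitude lam \<theta> n)" for n
  \<comment> \<open>The equation at site 0 will give 1 \<le> (lam + 4) (2 lam + 5) \<delta>, which
    this value excludes.\<close>
  define \<delta> where "\<delta> = 1 / ((lam + 4) * (2 * lam + 6))"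
  have \<delta>: "0 < \<delta>" using lam0 by (simp add: \<delta>_def)
  have \<epsilon>1: "\<epsilon> \<le> 1"
  proof -
    have "1 * \<epsilon> * 1 \<le> (lam + 4) * \<epsilon> * (2 * lam + 22) ^ k"
      using eps lam0 by (intro mult_mono one_le_power) auto
    then show ?thesis using small by simp
  qed
  have eq: "u (n + 1) + u (n - 1) + of_real (fib_potential lam \<theta> n) * u n = z * u n - (if n = 0 then \<i> else 0)" for n
    unfolding u_def by (rule resolvent_equation) (simp add: z_def eps)
  have half: "cmod (v 0) \<le> (lam + 4) * \<delta> \<and> cmod (v 1) \<le> (lam + 4) * \<delta>"
    if v: "\<And>m. 1 \<le> m \<Longrightarrow> m \<le> 2 * int (fib (2 * k - 2 + 3)) \<Longrightarrow>
              v (m + 1) = (z - of_real lam * of_int (fib_word \<theta>' m)) * v m - v (m - 1)"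
    and sm: "\<And>m. int (fib (2 * k - 2)) \<le> m \<Longrightarrow> cmod (v m) \<le> \<delta>" for v \<theta>'
  proof -
    \<comment> \<open>A square sought at level \<open>2 * k - 2\<close> has i \<le> 2 k, so its
      trace has index at most \<open>2 * k + 1\<close>, the last one controlled.\<close>
    have k5: "5 \<le> 2 * k - 2" using k by simp
    obtain i where i: "2 * k - 2 - 1 \<le> i" "i \<le> 2 * k - 2 + 2"
      and v01: "v 0 = trace_seq (of_real lam) z (i + 1) * v (int (fib (i + 1))) - v (2 * int (fib (i + 1)))"
        "v 1 = trace_seq (of_real lam) z (i + 1) * v (int (fib (i + 1)) + 1) - v (2 * int (fib (i + 1)) + 1)"
      using solution_at_square[OF k5 v] by blast
    have L: "fib (2 * k - 2) \<le> fib (i + 1)" using i by (intro fib_mono) simp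
    have t: "cmod (trace_seq (of_real lam) z (i + 1)) \<le> lam + 3"
      unfolding z_def by (rule tr) (use i k in simp)
    have "cmod (trace_seq (of_real lam) z (i + 1) * a - b) \<le> (lam + 4) * \<delta>"
      if "cmod a \<le> \<delta>" "cmod b \<le> \<delta>" for a b
    proof -
      have "cmod (trace_seq (of_real lam) z (i + 1) * a - b) \<le> cmod (trace_seq (of_real lam) z (i + 1)) * cmod a + cmod b"
        by (metis norm_mult norm_triangle_ineq4)
      also have "\<dots> \<le> (lam + 3) * \<delta> + \<delta>"
        using t that lam0 by (intro add_mono mult_mono) auto
      finally show ?thesis by (simp add: algebra_simps)
    qed
    then show ?thesis unfolding v01 using sm L by auto
  qed
  have "\<exists>n. int (fib (2 * k - 2)) \<le> \<bar>n\<bar> \<and> \<delta> \<le> cmod (u n)"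
  proof (rule ccontr)
    assume "\<not> ?thesis"
    then have sm: "cmod (u n) < \<delta>" if "int (fib (2 * k - 2)) \<le> \<bar>n\<bar>" for n using that by force
    have R: "cmod (u 0) \<le> (lam + 4) * \<delta> \<and> cmod (u 1) \<le> (lam + 4) * \<delta>"
    proof (rule half[of u \<theta>])
      show "u (m + 1) = (z - of_real lam * of_int (fib_word \<theta> m)) * u m - u (m - 1)" if "1 \<le> m" for m
        using eq[of m] that by (simp add: fib_potential_eq algebra_simps)
    qed (use sm in \<open>auto intro!: less_imp_le\<close>)
    obtain \<theta>' where \<theta>': "\<And>n. \<bar>n\<bar> \<le> 2 * int (fib (2 * k - 2 + 3)) \<Longrightarrow> fib_word \<theta> (- n) = fib_word \<theta>' n"
      using fib_word_reflect by blast
    \<comment> \<open>The reflected kernel solves the equation for the reflected word, which on this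
      window is the word of the phase \<theta>'.\<close>
    have L: "cmod (u (- 0)) \<le> (lam + 4) * \<delta> \<and> cmod (u (- 1)) \<le> (lam + 4) * \<delta>"
    proof (rule half[of "\<lambda>n. u (- n)" \<theta>'])
      show "u (- (m + 1)) = (z - of_real lam * of_int (fib_word \<theta>' m)) * u (- m) - u (- (m - 1))"
        if "1 \<le> m" "m \<le> 2 * int (fib (2 * k - 2 + 3))" for m
      proof -
        have "- m + 1 = - (m - 1)" "- m - 1 = - (m + 1)" by simp_all
        from eq[of "- m", unfolded this] show ?thesis
          using that \<theta>'[of m] by (simp add: fib_potential_eq algebra_simps)
      qed
    qed (use sm in \<open>auto intro!: less_imp_le\<close>)
    define V where "V = complex_of_real (fib_potential lam \<theta> 0)"
    have V: "cmod V \<le> lam" using fib_potential_bound[of lam \<theta> 0] lam0 by (simp add: V_def)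
    have zb: "cmod z \<le> lam + 3"
      using cmod_le[of z] E \<epsilon>1 eps lam0 by (simp add: z_def)
    have "- \<i> = u 1 + u (- 1) + (V - z) * u 0" using eq[of 0] by (simp add: V_def algebra_simps)
    then have "1 = cmod (u 1 + u (- 1) + (V - z) * u 0)" by (metis norm_ii norm_minus_cancel)
    also have "\<dots> \<le> cmod (u 1) + cmod (u (- 1)) + (cmod V + cmod z) * cmod (u 0)"
      using norm_triangle_ineq[of "u 1 + u (- 1)" "(V - z) * u 0"] norm_triangle_ineq[of "u 1" "u (- 1)"]
        mult_right_mono[OF norm_triangle_ineq4[of V z], of "cmod (u 0)"] by (simp add: norm_mult)
    also have "\<dots> \<le> (lam + 4) * \<delta> + (lam + 4) * \<delta> + (lam + (lam + 3)) * ((lam + 4) * \<delta>)"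
      using R L V zb lam0 by (intro add_mono mult_mono) auto
    also have "\<dots> = ((lam + 4) * (2 * lam + 5)) * \<delta>" by (simp add: algebra_simps)
    also have "\<dots> < ((lam + 4) * (2 * lam + 6)) * \<delta>"
      using \<delta> lam0 by (intro mult_strict_right_mono mult_strict_left_mono) auto
    also have "\<dots> = 1" using lam0 by (simp add: \<delta>_def)
    finally show False by simp
  qed
  then show ?thesis using that[of z] by (auto simp: z_def u_def \<delta>_def)
qed

section \<open>Averaged probability of a far site\<close>

lemma time_average_mono:
  "(\<And>t. f t \<le> g t) \<Longrightarrow> time_average f T \<le> time_average g T"
  unfolding time_average_def by (intro mult_left_mono nn_integral_mono) (auto simp: indicator_def mult_left_mono)

lemma time_average_cmult:
  assumes "f \<in> borel_measurable borel"
  shows "time_average (\<lambda>t. c * f t) T = c * time_average f T"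
proof -
  have "(\<integral>\<^sup>+t\<in>{0..}. ennreal (exp (- 2 * t / T)) * (c * f t) \<partial>lborel) =
      (\<integral>\<^sup>+t. c * (ennreal (exp (- 2 * t / T)) * f t * indicator {0..} t) \<partial>lborel)"
    by (simp add: mult_ac)
  also have "\<dots> = c * (\<integral>\<^sup>+t\<in>{0..}. ennreal (exp (- 2 * t / T)) * f t \<partial>lborel)"
    by (rule nn_integral_cmult) (use assms in measurable)
  finally show ?thesis by (simp add: time_average_def mult_ac)
qed

lemma site_prob_average:
  fixes lam \<theta> :: real
  assumes lam: "sqrt 24 < lam" and T: "0 < T" and k: "4 \<le> k"
    and small: "2 * (lam + 4) * (2 * lam + 22) ^ k \<le> T"
  obtains n where "int (fib (2 * k - 2)) \<le> \<bar>n\<bar>"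
    "ennreal ((2 / ((lam + 4) * (2 * lam + 6)))\<^sup>2 * T powr - 2) \<le>
       time_average (\<lambda>t. ennreal (site_prob (fib_hamiltonian lam \<theta>) t n)) T"
proof -
  define \<epsilon> where "\<epsilon> = 2 / T"
  have eps: "0 < \<epsilon>" using T by (simp add: \<epsilon>_def)
  have "(lam + 4) * \<epsilon> * (2 * lam + 22) ^ k \<le> 1"
    using small T by (simp add: \<epsilon>_def field_simps)
  from resolvent_lower_bound[OF lam eps k this]
  obtain z n where z: "Im z = \<epsilon>" and n: "int (fib (2 * k - 2)) \<le> \<bar>n\<bar>"
    and u: "1 / ((lam + 4) * (2 * lam + 6)) \<le> cmod (laplace z (amplitude lam \<theta> n))" .
  define \<delta> where "\<delta> = 1 / ((lam + 4) * (2 * lam + 6))"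
  have lam0: "0 < lam" using gt_sqrt_24[OF lam] by simp
  then have \<delta>: "0 < \<delta>" by (simp add: \<delta>_def)
  define I where "I = (\<integral>\<^sup>+t\<in>{0..}. ennreal (exp (- 2 * t / T)) * ennreal (site_prob (fib_hamiltonian lam \<theta>) t n) \<partial>lborel)"
  have "ennreal (\<delta>\<^sup>2) \<le> ennreal ((cmod (laplace z (amplitude lam \<theta> n)))\<^sup>2)"
    using u \<delta> by (intro ennreal_leI power_mono) (auto simp: \<delta>_def)
  also have "\<dots> \<le> ennreal (1 / \<epsilon>) * I"
    using laplace_bound[OF continuous_amplitude cmod_amplitude_le, of z lam \<theta> n] z eps
    by (simp add: I_def site_prob_amplitude \<epsilon>_def)
  \<comment> \<open>Multiplication by \<epsilon>^2 turns \<open>I\<close> divided by \<epsilon> into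
    \<epsilon> times \<open>I\<close>, the time average, as \<epsilon> = 2 / T.\<close>
  finally have "ennreal (\<epsilon> * \<epsilon>) * ennreal (\<delta>\<^sup>2) \<le> ennreal (\<epsilon> * \<epsilon>) * (ennreal (1 / \<epsilon>) * I)"
    by (rule mult_left_mono) simp
  also have "ennreal (\<epsilon> * \<epsilon>) * (ennreal (1 / \<epsilon>) * I) = ennreal (\<epsilon> * \<epsilon> * (1 / \<epsilon>)) * I"
    using eps by (subst ennreal_mult[of "\<epsilon> * \<epsilon>"]) (auto simp: mult.assoc)
  also have "\<epsilon> * \<epsilon> * (1 / \<epsilon>) = \<epsilon>" using eps by simp
  also have "ennreal (\<epsilon> * \<epsilon>) * ennreal (\<delta>\<^sup>2) = ennreal ((2 * \<delta>)\<^sup>2 * T powr - 2)"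
    using T eps by (simp add: \<epsilon>_def powr_minus power2_eq_square field_simps flip: ennreal_mult)
  finally show ?thesis
    using that[OF n] by (simp add: time_average_def I_def \<epsilon>_def \<delta>_def)
qed

lemma fib_ge_golden_power: "golden ^ n \<le> real (fib (n + 2))"
proof (induction n rule: induct_nat_012)
  case 1
  have "sqrt 5 \<le> sqrt (3\<^sup>2)" by (subst real_sqrt_le_iff) simp
  then have "golden \<le> 2" by (simp add: golden_def)
  then show ?case by (simp add: eval_nat_numeral)
next
  case (ge2 n)
  have "golden ^ Suc (Suc n) = golden ^ n * golden\<^sup>2" by (simp add: power2_eq_square)
  also have "\<dots> = golden ^ Suc n + golden ^ n" unfolding golden_square by (simp add: algebra_simps)
  also have "\<dots> \<le> real (fib (Suc (Suc n) + 2))" using ge2 by simp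
  finally show ?case .
qed simp

text \<open>Take the largest k with q m^k \<le> T. The site is then at distance at least golden^(2k
  - 4), which is T to the power \<alpha>0 up to a constant factor; \<alpha> < \<alpha>0 absorbs this
  factor for large T.\<close>

lemma far_site_average:
  fixes lam \<theta> :: real
  assumes lam: "sqrt 24 < lam" and \<alpha>: "\<alpha> < 2 * ln golden / ln (S_u lam)"
  obtains c where "0 < c" "\<forall>\<^sub>F T in at_top. \<exists>n::int. T powr \<alpha> \<le> of_int \<bar>n\<bar> \<and>
    ennreal (c * T powr - 2) \<le> time_average (\<lambda>t. ennreal (site_prob (fib_hamiltonian lam \<theta>) t n)) T"
proof (rule that)
  define m where "m = 2 * lam + 22"
  define q where "q = 2 * (lam + 4)"
  define \<alpha>0 where "\<alpha>0 = 2 * ln golden / ln m"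
  have lam0: "0 < lam" using gt_sqrt_24[OF lam] by simp
  have m: "1 < m" "0 < ln m" and q: "0 < q" using lam0 by (auto simp: m_def q_def)
  show "0 < (2 / ((lam + 4) * (2 * lam + 6)))\<^sup>2" using lam0 by simp
  \<comment> \<open>This makes x \<ge> 5 and hence k \<ge> 4. In the next condition, 6 arises from 2
    k - 4 \<ge> 2 x - 6.\<close>
  have "\<forall>\<^sub>F T in at_top. exp (ln q + 5 * ln m) \<le> T" by (rule eventually_ge_at_top)
  moreover have "\<forall>\<^sub>F T in at_top. exp ((\<alpha>0 * ln q + 6 * ln golden) / (\<alpha>0 - \<alpha>)) \<le> T" by (rule eventually_ge_at_top)
  moreover have "\<forall>\<^sub>F T in at_top. 1 \<le> (T::real)" by (rule eventually_ge_at_top)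
  ultimately show "\<forall>\<^sub>F T in at_top. \<exists>n::int. T powr \<alpha> \<le> of_int \<bar>n\<bar> \<and>
    ennreal ((2 / ((lam + 4) * (2 * lam + 6)))\<^sup>2 * T powr - 2) \<le> time_average (\<lambda>t. ennreal (site_prob (fib_hamiltonian lam \<theta>) t n)) T"
  proof eventually_elim
    case (elim T)
    have T: "0 < T" using elim by simp
    have l1: "ln q + 5 * ln m \<le> ln T" using elim(1) T by (simp add: ln_ge_iff)
    have l2: "\<alpha>0 * ln q + 6 * ln golden \<le> (\<alpha>0 - \<alpha>) * ln T"
    proof -
      have "(\<alpha>0 * ln q + 6 * ln golden) / (\<alpha>0 - \<alpha>) \<le> ln T" using elim(2) T by (simp add: ln_ge_iff)
      then show ?thesis using \<alpha> by (simp add: \<alpha>0_def m_def S_u_def field_simps)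
    qed
    define x where "x = (ln T - ln q) / ln m"
    define k where "k = nat \<lfloor>x\<rfloor>"
    have x: "5 \<le> x" using l1 m by (simp add: x_def field_simps)
    have k: "real k \<le> x" "x - 1 \<le> real k" using x by (auto simp: k_def)
    have k4: "4 \<le> k" using k x by linarith
    have "ln (q * m ^ k) = ln q + real k * ln m" using q m by (simp add: ln_mult ln_realpow)
    also have "\<dots> \<le> ln q + x * ln m" using k m by simp
    also have "\<dots> = ln T" using m by (simp add: x_def)
    finally have "q * m ^ k \<le> T" using q m T by (simp add: ln_le_cancel_iff)
    then obtain n where n: "int (fib (2 * k - 2)) \<le> \<bar>n\<bar>"
      "ennreal ((2 / ((lam + 4) * (2 * lam + 6)))\<^sup>2 * T powr - 2) \<le>
       time_average (\<lambda>t. ennreal (site_prob (fib_hamiltonian lam \<theta>) t n)) T"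
      using site_prob_average[OF lam T k4, of \<theta>] by (auto simp: q_def m_def)
    have "\<alpha> * ln T \<le> \<alpha>0 * (ln T - ln q) - 6 * ln golden" using l2 by (simp add: algebra_simps)
    also have "\<alpha>0 * (ln T - ln q) = 2 * x * ln golden" by (simp add: \<alpha>0_def x_def)
    also have "2 * x * ln golden - 6 * ln golden \<le> real (2 * k - 4) * ln golden"
    proof -
      have "(2 * x - 6) * ln golden \<le> real (2 * k - 4) * ln golden"
        using k k4 golden_gt_1 by (intro mult_right_mono) (auto simp: of_nat_diff)
      then show ?thesis by (simp add: algebra_simps)
    qed
    finally have "exp (\<alpha> * ln T) \<le> exp (real (2 * k - 4) * ln golden)" by simp
    then have "T powr \<alpha> \<le> golden ^ (2 * k - 4)"
      using T golden_pos by (simp add: powr_def exp_of_nat_mult)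
    also have "\<dots> \<le> real (fib (2 * k - 2))"
    proof -
      have "2 * k - 4 + 2 = 2 * k - 2" using k4 by simp
      then show ?thesis using fib_ge_golden_power[of "2 * k - 4"] by metis
    qed
    also have "\<dots> \<le> of_int \<bar>n\<bar>" using n(1) by linarith
    finally show ?case using n(2) by blast
  qed
qed

section \<open>From averaged probabilities to exponents\<close>

lemma ln_ennreal_ge:
  assumes "ennreal r \<le> x" "0 < r"
  shows "ereal (ln r) \<le> ln_ennreal x"
proof (cases x)
  case (real s)
  then have "r \<le> s" using assms by (simp add: ennreal_le_iff)
  then show ?thesis using assms real by (simp add: ln_ennreal_def)
qed (simp add: ln_ennreal_def)

text \<open>The constant \<open>c\<close> contributes only a multiple of 1 / ln T, which tends to
  0.\<close>

lemma Liminf_ln_ennreal_ge: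
  assumes c: "0 < c" and p: "0 < p" and X: "\<forall>\<^sub>F T in at_top. ennreal (c * T powr e) \<le> X T"
  shows "ereal (e / p) \<le> Liminf at_top (\<lambda>T. ln_ennreal (X T) / ereal (p * ln T))"
proof -
  define g where "g T = ln c / p * inverse (ln T) + e / p" for T
  have "(g \<longlongrightarrow> ln c / p * 0 + e / p) at_top"
    unfolding g_def by (intro tendsto_intros tendsto_inverse_0_at_top ln_at_top)
  then have "((\<lambda>T. ereal (g T)) \<longlongrightarrow> ereal (e / p)) at_top" by simp
  then have "ereal (e / p) = Liminf at_top (\<lambda>T. ereal (g T))"
    by (rule lim_imp_Liminf[OF trivial_limit_at_top_linorder, symmetric])
  also have "\<dots> \<le> Liminf at_top (\<lambda>T. ln_ennreal (X T) / ereal (p * ln T))"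
  proof (rule Liminf_mono)
    show "\<forall>\<^sub>F T in at_top. ereal (g T) \<le> ln_ennreal (X T) / ereal (p * ln T)"
      using X eventually_gt_at_top[of 1]
    proof eventually_elim
      case (elim T)
      then have l: "0 < ln T" by simp
      have "ereal (ln (c * T powr e)) / ereal (p * ln T) \<le> ln_ennreal (X T) / ereal (p * ln T)"
        using elim c p l by (intro ereal_divide_right_mono ln_ennreal_ge) auto
      moreover have "ln (c * T powr e) / (p * ln T) = g T"
        using c p l elim by (simp add: ln_mult ln_powr g_def field_simps)
      ultimately show ?case using p l by simp
    qed
  qed
  finally show ?thesis .
qed

lemma ennreal_le_infsum:
  fixes f :: "'a \<Rightarrow> ennreal"
  assumes "n \<in> A"
  shows "f n \<le> (\<Sum>\<^sub>\<infinity>x\<in>A. f x)"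
  using infsum_mono_neutral[of f "{n}" f A] assms by (simp add: nonneg_summable_on_complete)

lemma outside_prob_ge:
  assumes "N \<le> of_int \<bar>n\<bar>"
  shows "ennreal (site_prob A t n) \<le> outside_prob A N t"
proof (cases "0 \<le> n")
  case True
  then have "ennreal (site_prob A t n) \<le> (\<Sum>\<^sub>\<infinity>n\<in>{n. N \<le> of_int n}. ennreal (site_prob A t n))"
    using assms by (intro ennreal_le_infsum) auto
  then show ?thesis unfolding outside_prob_def by (rule order_trans) simp
next
  case False
  then have "ennreal (site_prob A t n) \<le> (\<Sum>\<^sub>\<infinity>n\<in>{n. of_int n \<le> - N}. ennreal (site_prob A t n))"
    using assms by (intro ennreal_le_infsum) auto
  then show ?thesis unfolding outside_prob_def by (rule order_trans) simp
qed

text \<open>The single far site already gives the bound 2 for \<open>S_minus\<close>.\<close>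

lemma S_minus_less_top:
  assumes lam: "sqrt 24 < lam" and \<alpha>: "\<alpha> < 2 * ln golden / ln (S_u lam)"
  shows "S_minus (fib_hamiltonian lam \<theta>) \<alpha> < \<infinity>"
proof -
  define A where "A = fib_hamiltonian lam \<theta>"
  obtain c where c: "0 < c" and ev: "\<forall>\<^sub>F T in at_top. \<exists>n::int. T powr \<alpha> \<le> of_int \<bar>n\<bar> \<and>
    ennreal (c * T powr - 2) \<le> time_average (\<lambda>t. ennreal (site_prob A t n)) T"
    using far_site_average[OF assms, of \<theta>] unfolding A_def by blast
  have "\<forall>\<^sub>F T in at_top. ennreal (c * T powr - 2) \<le> time_average (outside_prob A (T powr \<alpha> - 1)) T"
    using ev
  proof eventually_elim
    case (elim T)
    then obtain n :: int where n: "T powr \<alpha> \<le> of_int \<bar>n\<bar>"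
      "ennreal (c * T powr - 2) \<le> time_average (\<lambda>t. ennreal (site_prob A t n)) T" by blast
    note n(2)
    also have "time_average (\<lambda>t. ennreal (site_prob A t n)) T \<le> time_average (outside_prob A (T powr \<alpha> - 1)) T"
      using n(1) by (intro time_average_mono outside_prob_ge) simp
    finally show ?case .
  qed
  from Liminf_ln_ennreal_ge[OF c zero_less_one this]
  have "ereal (- 2) \<le> Liminf at_top (\<lambda>T. ln_ennreal (time_average (outside_prob A (T powr \<alpha> - 1)) T) / ereal (ln T))"
    by simp
  then have "S_minus A \<alpha> \<le> - ereal (- 2)"
    unfolding S_minus_def by (subst ereal_minus_le_minus)
  then show ?thesis unfolding A_def by (rule le_less_trans) simp
qed

text \<open>The far site alone contributes at least a multiple of T^(\<alpha> p - 2) to the averaged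
  moment; dividing the exponent by \<open>p\<close> gives the bound.\<close>

lemma beta_minus_ge:
  assumes lam: "sqrt 24 < lam" and \<alpha>: "0 \<le> \<alpha>" "\<alpha> < 2 * ln golden / ln (S_u lam)" and p: "0 < p"
  shows "ereal (\<alpha> - 2 / p) \<le> beta_minus (fib_hamiltonian lam \<theta>) p"
proof -
  define A where "A = fib_hamiltonian lam \<theta>"
  obtain c where c: "0 < c" and ev: "\<forall>\<^sub>F T in at_top. \<exists>n::int. T powr \<alpha> \<le> of_int \<bar>n\<bar> \<and>
    ennreal (c * T powr - 2) \<le> time_average (\<lambda>t. ennreal (site_prob A t n)) T"
    using far_site_average[OF lam \<alpha>(2), of \<theta>] unfolding A_def by blast
  have "\<forall>\<^sub>F T in at_top. ennreal (c * T powr (\<alpha> * p - 2)) \<le> time_average (moment A p) T"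
    using ev eventually_gt_at_top[of 0]
  proof eventually_elim
    case (elim T)
    then obtain n :: int where n: "T powr \<alpha> \<le> of_int \<bar>n\<bar>"
      "ennreal (c * T powr - 2) \<le> time_average (\<lambda>t. ennreal (site_prob A t n)) T" by blast
    have meas: "(\<lambda>t. ennreal (site_prob A t n)) \<in> borel_measurable borel"
    proof -
      have [measurable]: "amplitude lam \<theta> n \<in> borel_measurable borel"
        by (intro borel_measurable_continuous_onI continuous_amplitude)
      show ?thesis unfolding A_def site_prob_amplitude by measurable
    qed
    have "T powr (\<alpha> * p - 2) = T powr (\<alpha> * p) * T powr - 2" by (simp flip: powr_add)
    then have "ennreal (c * T powr (\<alpha> * p - 2)) = ennreal (T powr (\<alpha> * p)) * ennreal (c * T powr - 2)"
      using c by (simp add: mult_ac flip: ennreal_mult)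
    also have "\<dots> \<le> ennreal (\<bar>of_int n\<bar> powr p) * time_average (\<lambda>t. ennreal (site_prob A t n)) T"
    proof (intro mult_mono ennreal_leI n(2))
      show "T powr (\<alpha> * p) \<le> \<bar>of_int n\<bar> powr p"
        using powr_mono2[of p "T powr \<alpha>" "\<bar>of_int n\<bar>"] n(1) p by (simp add: powr_powr)
    qed auto
    also have "\<dots> = time_average (\<lambda>t. ennreal (\<bar>of_int n\<bar> powr p) * ennreal (site_prob A t n)) T"
      by (rule time_average_cmult[OF meas, symmetric])
    also have "\<dots> \<le> time_average (moment A p) T"
    proof (rule time_average_mono)
      fix t
      have "ennreal (\<bar>of_int n\<bar> powr p * site_prob A t n) \<le> moment A p t"
        unfolding moment_def by (rule ennreal_le_infsum) simp
      then show "ennreal (\<bar>of_int n\<bar> powr p) * ennreal (site_prob A t n) \<le> moment A p t"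
        by (simp add: ennreal_mult site_prob_def)
    qed
    finally show ?case .
  qed
  from Liminf_ln_ennreal_ge[OF c p this] show ?thesis
    using p by (simp add: beta_minus_def A_def diff_divide_distrib)
qed

theorem theorem3:
  shows "(\<exists>C::real. \<forall>lam \<theta> p :: real. lam > sqrt 24 \<longrightarrow> 0 \<le> \<theta> \<longrightarrow> \<theta> < 1 \<longrightarrow> p > 0 \<longrightarrow>
            beta_minus (fib_hamiltonian lam \<theta>) p \<ge>
              ereal (2 * ln golden / ln (S_u lam) - 2 / p * (1 + C * ln lam / ln (S_u lam)))) \<and>
         (\<forall>lam \<theta> :: real. lam > sqrt 24 \<longrightarrow> 0 \<le> \<theta> \<longrightarrow> \<theta> < 1 \<longrightarrow>
            alpha_u_minus (fib_hamiltonian lam \<theta>) \<ge> ereal (2 * ln golden / ln (S_u lam)))"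
proof -
  have pos: "0 < 2 * ln golden / ln (S_u lam)" if "sqrt 24 < lam" for lam
  proof -
    have "0 < lam" using gt_sqrt_24[OF that] by simp
    then show ?thesis using golden_gt_1 by (simp add: S_u_def)
  qed
  have "ereal (2 * ln golden / ln (S_u lam) - 2 / p) \<le> beta_minus (fib_hamiltonian lam \<theta>) p"
    if lam: "sqrt 24 < lam" and p: "0 < p" for lam \<theta> p
  proof (rule dense_le)
    fix x assume x: "x < ereal (2 * ln golden / ln (S_u lam) - 2 / p)"
    show "x \<le> beta_minus (fib_hamiltonian lam \<theta>) p"
    proof (cases x)
      case (real r)
      \<comment> \<open>The exponent \<alpha> solves \<alpha> - 2 / p = r, cut off at 0; as the
        threshold is positive, it remains below it.\<close>
      have "x \<le> ereal (max 0 (r + 2 / p) - 2 / p)" using real by simp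
      also have "\<dots> \<le> beta_minus (fib_hamiltonian lam \<theta>) p"
        using x real pos[OF lam] by (intro beta_minus_ge lam p) auto
      finally show ?thesis .
    qed (use x in auto)
  qed
  moreover have "ereal (2 * ln golden / ln (S_u lam)) \<le> alpha_u_minus (fib_hamiltonian lam \<theta>)"
    if lam: "sqrt 24 < lam" for lam \<theta>
  proof (rule dense_le)
    fix x assume x: "x < ereal (2 * ln golden / ln (S_u lam))"
    show "x \<le> alpha_u_minus (fib_hamiltonian lam \<theta>)"
    proof (cases x)
      case (real r)
      have "x \<le> ereal (max 0 r)" using real by simp
      also have "\<dots> \<le> alpha_u_minus (fib_hamiltonian lam \<theta>)"
        unfolding alpha_u_minus_def
        using S_minus_less_top[OF lam, of "max 0 r" \<theta>] x real pos[OF lam]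
        by (intro Sup_upper CollectI exI[of _ "max 0 r"] conjI) simp_all
      finally show ?thesis .
    qed (use x in auto)
  qed
  ultimately show ?thesis by (intro conjI exI[of _ 0]) auto
qed

end
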